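(* The generalized partition and assign problem (defined in the context) can be solved in $O(nk)$ time.
   Context: Generalized partition and assign problem: given $k$ thresholds $w_0^{(1)},\ldots,w_0^{(k)}$ and $n$ jobs $1,\ldots,n$ to process in order, where job $i$ is described by $(w_i,s_{i,1},\ldots,s_{i,k})$; all parameters are nonnegative. A group of consecutive jobs $i,\ldots,j$ can be processed in a batch by an agent of type $a\in\{1,\ldots,k\}$ if $w_i+\cdots+w_j\le w_0^{(a)}$, and the cost is then $\max\{s_{i,a},\ldots,s_{j,a}\}$. The task is to find a partition of $1,\ldots,n$ into consecutive groups and an assignment of an agent type to each group (respecting the weight condition) minimizing the total cost. Arithmetic operations and comparisons take $O(1)$ time. *)

theory Defs
  imports Complex_Main "HOL-Library.Disjoint_Sets"
begin

section \<open>The generalized partition and assign problem\<close>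

text \<open>Jobs are numbered from 1 to \<open>n\<close> and agent types from 1 to \<open>k\<close>; values of the
  parameters outside these ranges are irrelevant.\<close>

record pa_instance =
  njobs :: nat
  ntypes :: nat
  threshold :: "nat \<Rightarrow> real"
  weight :: "nat \<Rightarrow> real"
  setup_cost :: "nat \<Rightarrow> nat \<Rightarrow> real"

definition nonneg_instance :: "pa_instance \<Rightarrow> bool" where
  "nonneg_instance I \<longleftrightarrow>
     (\<forall>a\<in>{1..ntypes I}. 0 \<le> threshold I a) \<and>
     (\<forall>i\<in>{1..njobs I}. 0 \<le> weight I i) \<and>
     (\<forall>i\<in>{1..njobs I}. \<forall>a\<in>{1..ntypes I}. 0 \<le> setup_cost I i a)"

definition can_process :: "pa_instance \<Rightarrow> nat \<Rightarrow> nat set \<Rightarrow> bool" where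
  "can_process I a G \<longleftrightarrow> (\<Sum>i\<in>G. weight I i) \<le> threshold I a"

definition batch_cost :: "pa_instance \<Rightarrow> nat \<Rightarrow> nat set \<Rightarrow> real" where
  "batch_cost I a G = Max ((\<lambda>i. setup_cost I i a) ` G)"

text \<open>A candidate solution is a partition \<open>P\<close> of the jobs together with a map \<open>A\<close> giving the
  agent type of each group.  Groups are nonempty by the definition of \<^const>\<open>partition_on\<close>.\<close>

definition feasible :: "pa_instance \<Rightarrow> nat set set \<Rightarrow> (nat set \<Rightarrow> nat) \<Rightarrow> bool" where
  "feasible I P A \<longleftrightarrow>
     partition_on {1..njobs I} P \<and>
     (\<forall>G\<in>P. (\<exists>i j. G = {i..j}) \<and> A G \<in> {1..ntypes I} \<and> can_process I (A G) G)"

definition total_cost :: "pa_instance \<Rightarrow> nat set set \<Rightarrow> (nat set \<Rightarrow> nat) \<Rightarrow> real" where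
  "total_cost I P A = (\<Sum>G\<in>P. batch_cost I (A G) G)"

definition optimal :: "pa_instance \<Rightarrow> nat set set \<Rightarrow> (nat set \<Rightarrow> nat) \<Rightarrow> bool" where
  "optimal I P A \<longleftrightarrow>
     feasible I P A \<and> (\<forall>P' A'. feasible I P' A' \<longrightarrow> total_cost I P A \<le> total_cost I P' A')"

section \<open>Unit-cost random access machine\<close>

text \<open>Algorithms are while programs over a memory consisting of scalar variables and unbounded
  arrays, each holding either natural numbers (used for indices and counters) or real numbers.
  Reals can only be combined by field operations and compared; they cannot be
  rounded, converted to naturals or used as addresses, and the only literals are natural numbers.
  Subtraction of naturals is truncated and real division by zero yields zero.\<close>

datatype nexp =
    NLit nat
  | NVar string
  | NArr string nexp
  | NAdd nexp nexp
  | NSub nexp nexp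
  | NMul nexp nexp

datatype rexp =
    RLit nat
  | RVar string
  | RArr string nexp
  | RAdd rexp rexp
  | RSub rexp rexp
  | RMul rexp rexp
  | RDiv rexp rexp

datatype bexp =
    NLess nexp nexp
  | NEq nexp nexp
  | RLess rexp rexp
  | REq rexp rexp
  | Neg bexp
  | Conj bexp bexp

datatype com =
    Skip
  | NAssign string nexp
  | NStore string nexp nexp
  | RAssign string rexp
  | RStore string nexp rexp
  | Seq com com
  | Cond bexp com com
  | While bexp com

record memory =
  nvar :: "string \<Rightarrow> nat"
  narr :: "string \<Rightarrow> nat \<Rightarrow> nat"
  rvar :: "string \<Rightarrow> real"
  rarr :: "string \<Rightarrow> nat \<Rightarrow> real"

primrec nval :: "memory \<Rightarrow> nexp \<Rightarrow> nat" where
  "nval m (NLit c) = c"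
| "nval m (NVar x) = nvar m x"
| "nval m (NArr x e) = narr m x (nval m e)"
| "nval m (NAdd e f) = nval m e + nval m f"
| "nval m (NSub e f) = nval m e - nval m f"
| "nval m (NMul e f) = nval m e * nval m f"

primrec rval :: "memory \<Rightarrow> rexp \<Rightarrow> real" where
  "rval m (RLit c) = of_nat c"
| "rval m (RVar x) = rvar m x"
| "rval m (RArr x e) = rarr m x (nval m e)"
| "rval m (RAdd e f) = rval m e + rval m f"
| "rval m (RSub e f) = rval m e - rval m f"
| "rval m (RMul e f) = rval m e * rval m f"
| "rval m (RDiv e f) = rval m e / rval m f"

primrec bval :: "memory \<Rightarrow> bexp \<Rightarrow> bool" where
  "bval m (NLess e f) \<longleftrightarrow> nval m e < nval m f"
| "bval m (NEq e f) \<longleftrightarrow> nval m e = nval m f"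
| "bval m (RLess e f) \<longleftrightarrow> rval m e < rval m f"
| "bval m (REq e f) \<longleftrightarrow> rval m e = rval m f"
| "bval m (Neg b) \<longleftrightarrow> \<not> bval m b"
| "bval m (Conj b c) \<longleftrightarrow> bval m b \<and> bval m c"

text \<open>Every literal, memory access, arithmetic operation, comparison, Boolean connective,
  assignment and control-flow decision costs one time unit.\<close>

primrec ntime :: "nexp \<Rightarrow> nat" where
  "ntime (NLit c) = 1"
| "ntime (NVar x) = 1"
| "ntime (NArr x e) = 1 + ntime e"
| "ntime (NAdd e f) = 1 + ntime e + ntime f"
| "ntime (NSub e f) = 1 + ntime e + ntime f"
| "ntime (NMul e f) = 1 + ntime e + ntime f"

primrec rtime :: "rexp \<Rightarrow> nat" where
  "rtime (RLit c) = 1"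
| "rtime (RVar x) = 1"
| "rtime (RArr x e) = 1 + ntime e"
| "rtime (RAdd e f) = 1 + rtime e + rtime f"
| "rtime (RSub e f) = 1 + rtime e + rtime f"
| "rtime (RMul e f) = 1 + rtime e + rtime f"
| "rtime (RDiv e f) = 1 + rtime e + rtime f"

primrec btime :: "bexp \<Rightarrow> nat" where
  "btime (NLess e f) = 1 + ntime e + ntime f"
| "btime (NEq e f) = 1 + ntime e + ntime f"
| "btime (RLess e f) = 1 + rtime e + rtime f"
| "btime (REq e f) = 1 + rtime e + rtime f"
| "btime (Neg b) = 1 + btime b"
| "btime (Conj b c) = 1 + btime b + btime c"

text \<open>\<open>exec c m t m'\<close>: started in memory \<open>m\<close>, the program \<open>c\<close> halts after time \<open>t\<close> with
  memory \<open>m'\<close>.\<close>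

inductive exec :: "com \<Rightarrow> memory \<Rightarrow> nat \<Rightarrow> memory \<Rightarrow> bool" where
  exec_Skip: "exec Skip m 1 m"
| exec_NAssign:
    "exec (NAssign x e) m (1 + ntime e) (m\<lparr>nvar := (nvar m)(x := nval m e)\<rparr>)"
| exec_NStore:
    "exec (NStore x i e) m (1 + ntime i + ntime e)
       (m\<lparr>narr := (narr m)(x := (narr m x)(nval m i := nval m e))\<rparr>)"
| exec_RAssign:
    "exec (RAssign x e) m (1 + rtime e) (m\<lparr>rvar := (rvar m)(x := rval m e)\<rparr>)"
| exec_RStore:
    "exec (RStore x i e) m (1 + ntime i + rtime e)
       (m\<lparr>rarr := (rarr m)(x := (rarr m x)(nval m i := rval m e))\<rparr>)"
| exec_Seq:
    "exec c1 m t1 m' \<Longrightarrow> exec c2 m' t2 m'' \<Longrightarrow> exec (Seq c1 c2) m (t1 + t2) m''"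
| exec_CondTrue:
    "bval m b \<Longrightarrow> exec c1 m t m' \<Longrightarrow> exec (Cond b c1 c2) m (1 + btime b + t) m'"
| exec_CondFalse:
    "\<not> bval m b \<Longrightarrow> exec c2 m t m' \<Longrightarrow> exec (Cond b c1 c2) m (1 + btime b + t) m'"
| exec_WhileFalse:
    "\<not> bval m b \<Longrightarrow> exec (While b c) m (1 + btime b) m"
| exec_WhileTrue:
    "bval m b \<Longrightarrow> exec c m t1 m' \<Longrightarrow> exec (While b c) m' t2 m''
       \<Longrightarrow> exec (While b c) m (1 + btime b + t1 + t2) m''"

inductive_cases exec_elims:
  "exec Skip m t m'"
  "exec (NAssign x e) m t m'"
  "exec (NStore x i e) m t m'"
  "exec (RAssign x e) m t m'"
  "exec (RStore x i e) m t m'"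
  "exec (Seq c1 c2) m t m'"
  "exec (Cond b c1 c2) m t m'"

inductive_cases exec_WhileE: "exec (While b c) m t m'"

lemma exec_deterministic:
  "exec c m t m' \<Longrightarrow> exec c m u m'' \<Longrightarrow> t = u \<and> m' = m''"
proof (induction arbitrary: u m'' rule: exec.induct)
  case (exec_Seq c1 m t1 m1 c2 t2 m2)
  from exec_Seq.prems obtain t1' m1' t2'
    where *: "u = t1' + t2'" "exec c1 m t1' m1'" "exec c2 m1' t2' m''"
    by (rule exec_elims(6))
  from exec_Seq.IH(1)[OF *(2)] exec_Seq.IH(2)[of t2' m''] *(1,3)
  show ?case by simp
next
  case (exec_CondTrue m b c1 t m' c2)
  from exec_CondTrue.prems obtain t' where "u = 1 + btime b + t'" "exec c1 m t' m''"
    by (rule exec_elims(7)) (use exec_CondTrue.hyps(1) in simp_all)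
  with exec_CondTrue.IH[of t' m''] show ?case by simp
next
  case (exec_CondFalse m b c2 t m' c1)
  from exec_CondFalse.prems obtain t' where "u = 1 + btime b + t'" "exec c2 m t' m''"
    by (rule exec_elims(7)) (use exec_CondFalse.hyps(1) in simp_all)
  with exec_CondFalse.IH[of t' m''] show ?case by simp
next
  case (exec_WhileFalse m b c)
  from exec_WhileFalse.prems show ?case
    by (rule exec_WhileE) (use exec_WhileFalse.hyps in simp_all)
next
  case (exec_WhileTrue m b c t1 m1 t2 m2)
  from exec_WhileTrue.prems obtain t1' m1' t2'
    where *: "u = 1 + btime b + t1' + t2'" "exec c m t1' m1'" "exec (While b c) m1' t2' m''"
    by (rule exec_WhileE) (use exec_WhileTrue.hyps(1) in simp_all)
  from exec_WhileTrue.IH(1)[OF *(2)] exec_WhileTrue.IH(2)[of t2' m''] *(1,3)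
  show ?case by simp
next
  case exec_Skip
  then show ?case by (rule exec_elims(1)) simp
next
  case exec_NAssign
  then show ?case by (rule exec_elims(2)) simp
next
  case exec_NStore
  then show ?case by (rule exec_elims(3)) simp
next
  case exec_RAssign
  then show ?case by (rule exec_elims(4)) simp
next
  case exec_RStore
  then show ?case by (rule exec_elims(5)) simp
qed

section \<open>Input and output conventions\<close>

text \<open>Apart from the input, the memory is initially zero.  The cost matrix is stored row by row:
  its entry for job \<open>i\<close> and agent type \<open>a\<close> is in cell \<open>(i - 1) * k + a\<close>.\<close>

definition input_memory :: "pa_instance \<Rightarrow> memory" where
  "input_memory I =
     \<lparr> nvar = (\<lambda>_. 0)(''n'' := njobs I, ''k'' := ntypes I),
       narr = (\<lambda>_ _. 0),
       rvar = (\<lambda>_. 0),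
       rarr = (\<lambda>_ _. 0)
         (''threshold'' := (\<lambda>a. if a \<in> {1..ntypes I} then threshold I a else 0),
          ''weight'' := (\<lambda>i. if i \<in> {1..njobs I} then weight I i else 0),
          ''cost'' := (\<lambda>p. if p \<in> {1..njobs I * ntypes I}
             then setup_cost I ((p - 1) div ntypes I + 1) ((p - 1) mod ntypes I + 1)
             else 0)) \<rparr>"

lemma input_memory_cost:
  assumes "i \<in> {1..njobs I}" and "a \<in> {1..ntypes I}"
  shows "rarr (input_memory I) ''cost'' ((i - 1) * ntypes I + a) = setup_cost I i a"
proof -
  obtain i' where i: "i = Suc i'" "i' < njobs I"
    using assms(1) by (cases i) auto
  obtain a' where a: "a = Suc a'" "a' < ntypes I"
    using assms(2) by (cases a) auto
  have "Suc i' * ntypes I \<le> njobs I * ntypes I"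
    using i(2) by (intro mult_le_mono1) simp
  then have bound: "i' * ntypes I + Suc a' \<le> njobs I * ntypes I"
    using a(2) by simp
  have row: "(i' * ntypes I + a') div ntypes I = i'"
    using a(2) div_mult_self1[of "ntypes I" a' i'] by (simp add: add.commute)
  show ?thesis
    using bound a(2) by (simp add: input_memory_def i(1) a(1) row)
qed

text \<open>A solution with \<open>r\<close> groups is returned by setting the variable \<open>groups\<close> to \<open>r\<close> and
  storing, for \<open>1 \<le> g \<le> r\<close>, the last job and the agent type of the \<open>g\<close>th group in cell \<open>g\<close> of
  the arrays \<open>end\<close> and \<open>agent\<close>; cell 0 of \<open>end\<close> holds 0.\<close>

definition output_group :: "memory \<Rightarrow> nat \<Rightarrow> nat set" where
  "output_group m g = {narr m ''end'' (g - 1) + 1 .. narr m ''end'' g}"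

definition returns_solution :: "memory \<Rightarrow> nat set set \<Rightarrow> (nat set \<Rightarrow> nat) \<Rightarrow> bool" where
  "returns_solution m P A \<longleftrightarrow>
     narr m ''end'' 0 = 0 \<and>
     P = output_group m ` {1..nvar m ''groups''} \<and>
     (\<forall>g\<in>{1..nvar m ''groups''}. A (output_group m g) = narr m ''agent'' g)"

text \<open>The variable \<open>feasible\<close> tells whether the instance has a solution at all.\<close>

definition correct_output :: "pa_instance \<Rightarrow> memory \<Rightarrow> bool" where
  "correct_output I m \<longleftrightarrow>
     (if \<exists>P A. feasible I P A
      then nvar m ''feasible'' = 1 \<and> (\<exists>P A. returns_solution m P A \<and> optimal I P A)
      else nvar m ''feasible'' = 0)"

text \<open>A single program \<open>c\<close> has to solve the instances of all sizes.  A bound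
  \<open>T n k = C * max 1 (n * k)\<close> is \<open>O(nk)\<close> on instances with \<open>n, k \<ge> 1\<close>; the maximum only
  accounts for the degenerate instances with \<open>n * k = 0\<close>, since no program halts in time 0.\<close>

definition solves_in_time :: "com \<Rightarrow> (nat \<Rightarrow> nat \<Rightarrow> nat) \<Rightarrow> bool" where
  "solves_in_time c T \<longleftrightarrow>
     (\<forall>I. nonneg_instance I \<longrightarrow>
        (\<exists>t m. exec c (input_memory I) t m \<and> t \<le> T (njobs I) (ntypes I) \<and> correct_output I m))"

end

theory Submission
  imports Defs
begin

text \<open>Let \<open>f j\<close> be the least cost of processing the jobs \<open>1, \<dots>, j\<close>; it is monotone in \<open>j\<close>, and
  \<open>f j = min (f st + max {s i a | st < i \<le> j})\<close> over the types \<open>a\<close> and the starts \<open>st\<close> in the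
  window \<open>L \<le> st < j\<close> allowed by the threshold of \<open>a\<close>, where \<open>L\<close> only moves to the right.  For each
  type, the running maxima cut the window into blocks of starts with the same maximum, kept as a
  monotone deque; by monotonicity of \<open>f\<close> only the left end of each block matters.  The
  minimum over the blocks is maintained in amortized constant time by splitting the deque at a
  position \<open>mid\<close>: minima of the ranges ending at \<open>mid\<close> are stored to its left, and minima of the ranges
  starting after \<open>mid\<close> to its right.  The value of the leftmost block changes with \<open>L\<close>, so it is kept
  apart.  When one side is used up, the deque is split anew in the middle, which is paid for by the
  potential \<open>\<bar>2 * mid - lo - hi\<bar>\<close>.\<close>

section \<open>Weakest preconditions with running time\<close>

text \<open>Along a deque the left ends, and with them \<open>f\<close>, go up while the block
  maxima go down. The best block can therefore be anywhere and has to be found as a range minimum; a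
  heap would cost a logarithmic factor, and one stack of minima cannot serve blocks leaving at both
  ends. With the split, an end of the deque makes stored minima unusable only by coming up to
  \<open>mid\<close>; at that moment the imbalance is at least the number of blocks minus 2, while a
  move of an end changes it by at most 1. Nonnegative weights keep discarded starts inadmissible
  forever, nonnegative costs make \<open>f\<close> monotone. What remains is an amortized constant
  per job and type: the time claims have the shape time plus new potential at most old potential
  plus a constant, with generous constants. As \<open>wp\<close> asserts that a run exists and hands
  its time to the postcondition, time and result are treated together. Degenerate sizes shape the
  program as well: for \<open>n = 0\<close> there is no time for a loop over the types, so the
  zeroed memory must already be a valid start, and for \<open>k = 0\<close> the first job must stop
  the main loop.\<close>

definition wp :: "com \<Rightarrow> (nat \<Rightarrow> memory \<Rightarrow> bool) \<Rightarrow> memory \<Rightarrow> bool" where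
  "wp c Q m \<longleftrightarrow> (\<exists>t m'. exec c m t m' \<and> Q t m')"

lemma wp_mono: "wp c Q m \<Longrightarrow> (\<And>t m'. Q t m' \<Longrightarrow> Q' t m') \<Longrightarrow> wp c Q' m"
  unfolding wp_def by blast

lemma wp_Skip: "wp Skip Q m \<longleftrightarrow> Q 1 m"
  unfolding wp_def by (rule iffI, (elim exE conjE, erule exec_elims, simp), (intro exI conjI, rule exec.intros, assumption))

lemma wp_NAssign:
  "wp (NAssign x e) Q m \<longleftrightarrow> Q (1 + ntime e) (m\<lparr>nvar := (nvar m)(x := nval m e)\<rparr>)"
  unfolding wp_def by (rule iffI, (elim exE conjE, erule exec_elims, simp), (intro exI conjI, rule exec.intros, assumption))

lemma wp_NStore:
  "wp (NStore x i e) Q m \<longleftrightarrow> Q (1 + ntime i + ntime e)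
     (m\<lparr>narr := (narr m)(x := (narr m x)(nval m i := nval m e))\<rparr>)"
  unfolding wp_def by (rule iffI, (elim exE conjE, erule exec_elims, simp), (intro exI conjI, rule exec.intros, assumption))

lemma wp_RAssign:
  "wp (RAssign x e) Q m \<longleftrightarrow> Q (1 + rtime e) (m\<lparr>rvar := (rvar m)(x := rval m e)\<rparr>)"
  unfolding wp_def by (rule iffI, (elim exE conjE, erule exec_elims, simp), (intro exI conjI, rule exec.intros, assumption))

lemma wp_RStore:
  "wp (RStore x i e) Q m \<longleftrightarrow> Q (1 + ntime i + rtime e)
     (m\<lparr>rarr := (rarr m)(x := (rarr m x)(nval m i := rval m e))\<rparr>)"
  unfolding wp_def by (rule iffI, (elim exE conjE, erule exec_elims, simp), (intro exI conjI, rule exec.intros, assumption))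

lemma wp_Seq: "wp (Seq c1 c2) Q m \<longleftrightarrow> wp c1 (\<lambda>t1. wp c2 (\<lambda>t2. Q (t1 + t2))) m"
  unfolding wp_def by (blast intro: exec_Seq elim: exec_elims)

lemma wp_Cond:
  "wp (Cond b c1 c2) Q m \<longleftrightarrow>
     (bval m b \<longrightarrow> wp c1 (\<lambda>t. Q (1 + btime b + t)) m) \<and>
     (\<not> bval m b \<longrightarrow> wp c2 (\<lambda>t. Q (1 + btime b + t)) m)"
proof (cases "bval m b")
  case True
  have "(\<exists>t m'. exec (Cond b c1 c2) m t m' \<and> Q t m') \<longleftrightarrow>
      (\<exists>t m'. exec c1 m t m' \<and> Q (1 + btime b + t) m')"
    proof
    show "\<exists>t m'. exec (Cond b c1 c2) m t m' \<and> Q t m'"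
      if "\<exists>t m'. exec c1 m t m' \<and> Q (1 + btime b + t) m'"
      using that exec_CondTrue[OF True] by blast
  qed (use True in \<open>auto elim!: exec_elims(7)\<close>)
  with True show ?thesis unfolding wp_def by blast
next
  case False
  have "(\<exists>t m'. exec (Cond b c1 c2) m t m' \<and> Q t m') \<longleftrightarrow>
      (\<exists>t m'. exec c2 m t m' \<and> Q (1 + btime b + t) m')"
    proof
    show "\<exists>t m'. exec (Cond b c1 c2) m t m' \<and> Q t m'"
      if "\<exists>t m'. exec c2 m t m' \<and> Q (1 + btime b + t) m'"
      using that exec_CondFalse[OF False] by blast
  qed (use False in \<open>auto elim!: exec_elims(7)\<close>)
  with False show ?thesis unfolding wp_def by blast
qed

text \<open>The potential \<open>\<Phi>\<close> both bounds the time and makes the loop terminate.\<close>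

lemma wp_While:
  assumes "Inv m"
    and step: "\<And>m. Inv m \<Longrightarrow> bval m b \<Longrightarrow>
      wp c (\<lambda>t m'. Inv m' \<and> t + 1 + btime b + \<Phi> m' \<le> \<Phi> m) m"
    and post: "\<And>t m'. Inv m' \<Longrightarrow> \<not> bval m' b \<Longrightarrow> t + \<Phi> m' \<le> \<Phi> m + 1 + btime b \<Longrightarrow> Q t m'"
  shows "wp (While b c) Q m"
proof -
  have "\<exists>t m'. exec (While b c) m t m' \<and> Inv m' \<and> \<not> bval m' b \<and> t + \<Phi> m' \<le> \<Phi> m + 1 + btime b"
    using assms(1)
  proof (induction "\<Phi> m" arbitrary: m rule: less_induct)
    case less
    show ?case
    proof (cases "bval m b")
      case False
      then show ?thesis using exec_WhileFalse[OF False, of c] less.prems by fastforce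
    next
      case True
      from step[OF less.prems True] obtain t1 m1
        where 1: "exec c m t1 m1" "Inv m1" "t1 + 1 + btime b + \<Phi> m1 \<le> \<Phi> m"
        unfolding wp_def by blast
      then have "\<Phi> m1 < \<Phi> m" by simp
      from less.hyps[OF this 1(2)] obtain t2 m2
        where 2: "exec (While b c) m1 t2 m2" "Inv m2" "\<not> bval m2 b"
          "t2 + \<Phi> m2 \<le> \<Phi> m1 + 1 + btime b" by blast
      from exec_WhileTrue[OF True 1(1) 2(1)] 1 2 show ?thesis
        by (intro exI[of _ "1 + btime b + t1 + t2"] exI[of _ m2]) simp
    qed
  qed
  then show ?thesis unfolding wp_def using post by blast
qed

lemmas wp_simps = wp_Skip wp_NAssign wp_NStore wp_RAssign wp_RStore wp_Seq wp_Cond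

section \<open>Monotone deques\<close>

text \<open>The job positions \<open>D lo < \<dots> < D hi\<close> cut the window \<open>{D lo<..D hi}\<close> into blocks
  \<open>{D t<..D (Suc t)}\<close>, each having its maximum at its right end, and these maxima decrease.\<close>

definition deque :: "(nat \<Rightarrow> real) \<Rightarrow> (nat \<Rightarrow> nat) \<Rightarrow> nat \<Rightarrow> nat \<Rightarrow> bool" where
  "deque s D lo hi \<longleftrightarrow> lo \<le> hi \<and>
     (\<forall>t. lo \<le> t \<and> t < hi \<longrightarrow> D t < D (Suc t)) \<and>
     (\<forall>t. lo < t \<and> t < hi \<longrightarrow> s (D (Suc t)) < s (D t)) \<and>
     (\<forall>t x. lo \<le> t \<and> t < hi \<and> D t < x \<and> x \<le> D (Suc t) \<longrightarrow> s x \<le> s (D (Suc t)))"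

lemma deque_less:
  assumes "deque s D lo hi" "lo \<le> t" "t < u" "u \<le> hi"
  shows "D t < D u"
  using assms(3,4)
proof (induction u)
  case (Suc u)
  have "D u < D (Suc u)"
    using assms(1,2) Suc.prems unfolding deque_def by auto
  then show ?case using Suc by (cases "t = u") auto
qed simp

lemma deque_pop_right: "deque s D lo hi \<Longrightarrow> lo < hi \<Longrightarrow> deque s D lo (hi - Suc 0)"
  unfolding deque_def by auto

text \<open>\<open>h\<close> is the right index left after popping. The new block reaches from
  \<open>D h\<close> to \<open>j\<close>, so the jobs in between must be dominated by
  \<open>s j\<close>. For \<open>h = lo\<close> there is nothing to compare with, since
  \<open>D lo\<close> only marks the left border and is no block maximum.\<close>

lemma deque_push:
  assumes "deque s D lo h" "D h < j" "lo < h \<Longrightarrow> s j < s (D h)" "\<And>x. D h < x \<Longrightarrow> x < j \<Longrightarrow> s x \<le> s j"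
  shows "deque s (D(Suc h := j)) lo (Suc h)"
proof -
  have "s x \<le> s j" if "D h < x" "x \<le> j" for x
    using that assms(4) by (cases "x = j") auto
  then show ?thesis using assms(1-3) unfolding deque_def by (auto simp: less_Suc_eq)
qed

text \<open>The old \<open>D (Suc lo)\<close> turns from a block maximum into the left border.
  Maxima are compared strictly above the left index only, so no condition has to be established
  anew.\<close>

lemma deque_pop_left: "deque s D lo hi \<Longrightarrow> lo < hi \<Longrightarrow> deque s D (Suc lo) hi"
  unfolding deque_def by auto

text \<open>A block keeps its maximum when jobs are cut off its left side, as long as its right end
  stays.\<close>

lemma deque_shrink_left:
  "deque s D lo hi \<Longrightarrow> D lo \<le> l \<Longrightarrow> (lo < hi \<Longrightarrow> l < D (Suc lo)) \<Longrightarrow> deque s (D(lo := l)) lo hi"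
  unfolding deque_def by auto

text \<open>Block maxima decrease to the right, so the one of block \<open>t\<close> also dominates
  all later blocks. It is thus the cost of a group that starts after \<open>D t\<close> and ends at
  \<open>D hi\<close>.\<close>

lemma deque_max:
  assumes d: "deque s D lo hi" and t: "lo \<le> t" "t < hi" and x: "D t < x" "x \<le> D hi"
  shows "s x \<le> s (D (Suc t))"
proof -
  have "\<forall>x. D t < x \<and> x \<le> D u \<longrightarrow> s x \<le> s (D (Suc t))" if "Suc t \<le> u" "u \<le> hi" for u
    using that
  proof (induction u rule: dec_induct)
    case base
    show ?case using d t unfolding deque_def by blast
  next
    case (step u)
    have u: "s (D (Suc u)) < s (D u)" "\<forall>x. D u < x \<and> x \<le> D (Suc u) \<longrightarrow> s x \<le> s (D (Suc u))"
      using d t step.prems step.hyps unfolding deque_def by auto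
    moreover have "D t < D u" using deque_less[OF d] t step.prems step.hyps by simp
    moreover have "D (Suc t) \<le> D u"
      using deque_less[OF d, of "Suc t" u] t step.prems step.hyps by (cases "Suc t = u") auto
    ultimately have "s (D u) \<le> s (D (Suc t))" "\<forall>x. D t < x \<and> x \<le> D u \<longrightarrow> s x \<le> s (D (Suc t))"
      using step by auto
    with u show ?case by (meson le_less_linear less_imp_le order_trans)
  qed
  from this[of hi] show ?thesis using x t by auto
qed

lemma deque_block:
  assumes d: "deque s D lo hi" and x: "D lo \<le> x" "x < D hi"
  obtains t where "lo \<le> t" "t < hi" "D t \<le> x" "x < D (Suc t)"
proof -
  have "lo \<le> hi" using d unfolding deque_def by simp
  then have "x < D hi \<longrightarrow> (\<exists>t. lo \<le> t \<and> t < hi \<and> D t \<le> x \<and> x < D (Suc t))"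
  proof (induction hi rule: dec_induct)
    case base
    show ?case using x by simp
  next
    case (step u)
    then show ?case by (metis less_Suc_eq linorder_not_le)
  qed
  then show ?thesis using x(2) that by blast
qed

text \<open>As \<open>f\<close> is monotone, the best start in block \<open>x\<close> is its left end \<open>D x\<close>, which gives the value
  \<open>f (D x) + s (D (Suc x))\<close>.\<close>

definition ismin ::
  "(nat \<Rightarrow> real) \<Rightarrow> (nat \<Rightarrow> real) \<Rightarrow> (nat \<Rightarrow> nat) \<Rightarrow> real \<Rightarrow> nat \<Rightarrow> nat \<Rightarrow> nat \<Rightarrow> bool" where
  "ismin f s D r b u v \<longleftrightarrow>
     (\<forall>x\<in>{u..v}. r \<le> f (D x) + s (D (Suc x))) \<and>
     (\<exists>x\<in>{u..v}. r = f (D x) + s (D (Suc x)) \<and> b = D x)"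

lemma ismin_single: "ismin f s D (f (D x) + s (D (Suc x))) (D x) x x"
  unfolding ismin_def by auto

text \<open>The value of block \<open>v\<close> also reads its right end \<open>D (Suc v)\<close>,
  whence the range up to \<open>Suc v\<close> for \<open>D'\<close>.\<close>

lemma ismin_cong:
  assumes "ismin f s D r b u v"
    and "\<And>x. u \<le> x \<Longrightarrow> x \<le> Suc v \<Longrightarrow> D' x = D x" "\<And>x. u \<le> x \<Longrightarrow> x \<le> v \<Longrightarrow> f' (D x) = f (D x)"
  shows "ismin f' s D' r b u v"
  using assms unfolding ismin_def by auto

text \<open>A relation, so that both branches of the program yield one and the same fact. Ties go to
  the second pair, as in the strict comparison of \<open>combine_min\<close>.\<close>

definition combined :: "real \<Rightarrow> nat \<Rightarrow> real \<Rightarrow> nat \<Rightarrow> real \<Rightarrow> nat \<Rightarrow> bool" where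
  "combined r b g d r' b' \<longleftrightarrow> (if r < g then r' = r \<and> b' = b else r' = g \<and> b' = d)"

lemma ismin_extend_right:
  assumes "ismin f s D r b u v" "combined r b (f (D (Suc v)) + s (D (Suc (Suc v)))) (D (Suc v)) r' b'"
  shows "ismin f s D r' b' u (Suc v)"
proof -
  have "u \<le> v" using assms(1) unfolding ismin_def by auto
  then have "{u..Suc v} = insert (Suc v) {u..v}" by auto
  then show ?thesis using assms unfolding ismin_def combined_def
    by (auto split: if_splits)
qed

lemma ismin_extend_left:
  assumes "ismin f s D r b (Suc u) v" "combined r b (f (D u) + s (D (Suc u))) (D u) r' b'"
  shows "ismin f s D r' b' u v"
proof -
  have "Suc u \<le> v" using assms(1) unfolding ismin_def by auto
  then have "{u..v} = insert u {Suc u..v}" by auto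
  then show ?thesis using assms unfolding ismin_def combined_def
    by (auto split: if_splits)
qed

section \<open>Representation of the deques\<close>

text \<open>Every agent type owns one row of the arrays \<open>D\<close>, \<open>mv\<close> and \<open>ms\<close>, which are laid out like
  the cost matrix.\<close>

definition cell :: "nat \<Rightarrow> nat \<Rightarrow> nat \<Rightarrow> nat" where
  "cell k a t = t * k + a"

lemma cell_eq_iff:
  assumes "a \<in> {1..k}" "b \<in> {1..k}"
  shows "cell k a t = cell k b u \<longleftrightarrow> a = b \<and> t = u"
proof
  assume eq: "cell k a t = cell k b u"
  \<comment> \<open>Types count from 1, so 1 has to be subtracted before quotient and remainder
    modulo \<open>k\<close> recover index and type.\<close>
  have *: "(t * k + a - 1) div k = t \<and> (t * k + a - 1) mod k = a - 1" if "a \<in> {1..k}" for t a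
  proof -
    have "t * k + a - 1 = (a - 1) + t * k" "a - 1 < k" "k \<noteq> 0" using that by auto
    then show ?thesis by (metis add.right_neutral div_less div_mult_self1 mod_less mod_mult_self1 add.commute add_0)
  qed
  show "a = b \<and> t = u"
    using *[of a t] *[of b u] eq assms unfolding cell_def by (metis One_nat_def Suc_pred atLeastAtMost_iff less_eq_Suc_le)
qed simp

definition Cell :: "nexp \<Rightarrow> nexp" where
  "Cell e = NAdd (NMul e (NVar ''k'')) (NVar ''a'')"

lemma nval_Cell [simp]: "nval m (Cell e) = cell (nvar m ''k'') (nvar m ''a'') (nval m e)"
  unfolding Cell_def cell_def by simp

lemma ntime_Cell [simp]: "ntime (Cell e) = ntime e + 4"
  unfolding Cell_def by simp

definition row :: "nat \<Rightarrow> nat \<Rightarrow> (nat \<Rightarrow> 'b) \<Rightarrow> nat \<Rightarrow> 'b" where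
  "row k a X = (\<lambda>t. X (cell k a t))"

lemma row_apply [simp]: "row k a X t = X (cell k a t)"
  unfolding row_def by simp

lemma row_upd:
  assumes "a \<in> {1..k}" "b \<in> {1..k}"
  shows "row k b (X(cell k a t := v)) = (if b = a then (row k a X)(t := v) else row k b X)"
  using assms by (auto simp: row_def fun_eq_iff cell_eq_iff)

abbreviation Lo :: nexp where "Lo \<equiv> NArr ''lo'' (NVar ''a'')"
abbreviation Hi :: nexp where "Hi \<equiv> NArr ''hi'' (NVar ''a'')"
abbreviation Mid :: nexp where "Mid \<equiv> NArr ''mid'' (NVar ''a'')"
abbreviation Left :: nexp where "Left \<equiv> NArr ''L'' (NVar ''a'')"
abbreviation D_at :: "nexp \<Rightarrow> nexp" where "D_at e \<equiv> NArr ''D'' (Cell e)"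
abbreviation Price :: "nexp \<Rightarrow> rexp" where "Price e \<equiv> RArr ''cost'' (Cell (NSub e (NLit 1)))"
abbreviation Block_value :: "nexp \<Rightarrow> rexp" where
  "Block_value e \<equiv> RAdd (RArr ''f'' (D_at e)) (Price (D_at (NAdd e (NLit 1))))"

definition price :: "memory \<Rightarrow> nat \<Rightarrow> nat \<Rightarrow> real" where
  "price m a i = rarr m ''cost'' (cell (nvar m ''k'') a (i - 1))"

definition D_row :: "memory \<Rightarrow> nat \<Rightarrow> nat \<Rightarrow> nat" where
  "D_row m a = row (nvar m ''k'') a (narr m ''D'')"

definition mv_row :: "memory \<Rightarrow> nat \<Rightarrow> nat \<Rightarrow> real" where
  "mv_row m a = row (nvar m ''k'') a (rarr m ''mv'')"

definition ms_row :: "memory \<Rightarrow> nat \<Rightarrow> nat \<Rightarrow> nat" where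
  "ms_row m a = row (nvar m ''k'') a (narr m ''ms'')"

abbreviation valid_type :: "memory \<Rightarrow> bool" where
  "valid_type m \<equiv> nvar m ''a'' \<in> {1..nvar m ''k''}"

definition same_env :: "memory \<Rightarrow> memory \<Rightarrow> bool" where
  "same_env m m' \<longleftrightarrow>
     nvar m' ''n'' = nvar m ''n'' \<and> nvar m' ''k'' = nvar m ''k'' \<and> nvar m' ''a'' = nvar m ''a'' \<and>
     nvar m' ''j'' = nvar m ''j'' \<and> nvar m' ''feasible'' = nvar m ''feasible'' \<and>
     rarr m' ''weight'' = rarr m ''weight'' \<and> rarr m' ''cost'' = rarr m ''cost'' \<and>
     rarr m' ''threshold'' = rarr m ''threshold'' \<and> rarr m' ''f'' = rarr m ''f'' \<and>
     narr m' ''cnt'' = narr m ''cnt'' \<and> narr m' ''pred'' = narr m ''pred'' \<and>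
     narr m' ''typ'' = narr m ''typ'' \<and> narr m' ''end'' = narr m ''end''"

definition same_window :: "nat \<Rightarrow> memory \<Rightarrow> memory \<Rightarrow> bool" where
  "same_window b m m' \<longleftrightarrow>
     narr m' ''L'' b = narr m ''L'' b \<and> rarr m' ''S'' b = rarr m ''S'' b \<and>
     narr m' ''lo'' b = narr m ''lo'' b \<and> narr m' ''hi'' b = narr m ''hi'' b \<and>
     D_row m' b = D_row m b"

definition same_minima :: "nat \<Rightarrow> memory \<Rightarrow> memory \<Rightarrow> bool" where
  "same_minima b m m' \<longleftrightarrow> narr m' ''mid'' b = narr m ''mid'' b \<and>
     mv_row m' b = mv_row m b \<and> ms_row m' b = ms_row m b"

definition same_best :: "memory \<Rightarrow> memory \<Rightarrow> bool" where
  "same_best m m' \<longleftrightarrow> nvar m' ''bt'' = nvar m ''bt'' \<and> nvar m' ''bs'' = nvar m ''bs'' \<and>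
     rvar m' ''bv'' = rvar m ''bv''"

text \<open>The time bound sums potentials over all types, so work on the current type must be known
  to leave the deques of all others unchanged.\<close>

definition frame :: "memory \<Rightarrow> memory \<Rightarrow> bool" where
  "frame m m' \<longleftrightarrow> same_env m m' \<and>
     (\<forall>b\<in>{1..nvar m ''k''}. b \<noteq> nvar m ''a'' \<longrightarrow> same_window b m m' \<and> same_minima b m m')"

lemmas same_defs = same_env_def same_window_def same_minima_def same_best_def

lemma frame_refl [simp]: "frame m m" "same_window b m m" "same_best m m" "same_minima b m m" "same_env m m"
  unfolding frame_def same_defs by auto

lemma frame_trans: "frame m m' \<Longrightarrow> frame m' m'' \<Longrightarrow> frame m m''"
  unfolding frame_def same_defs by auto

lemma same_window_trans: "same_window b m m' \<Longrightarrow> same_window b m' m'' \<Longrightarrow> same_window b m m''"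
  unfolding same_defs by auto

lemma same_best_trans: "same_best m m' \<Longrightarrow> same_best m' m'' \<Longrightarrow> same_best m m''"
  unfolding same_defs by auto

lemma frame_price: "frame m m' \<Longrightarrow> price m' = price m"
  unfolding frame_def same_env_def price_def by auto

section \<open>Running minima over the blocks\<close>

definition set_min :: com where
  "set_min =
     Seq (RStore ''mv'' (Cell (NVar ''x'')) (Block_value (NVar ''x'')))
         (NStore ''ms'' (Cell (NVar ''x'')) (D_at (NVar ''x'')))"

definition combine_min :: com where
  "combine_min =
     Cond (RLess (RArr ''mv'' (Cell (NVar ''y''))) (Block_value (NVar ''x'')))
       (Seq (RStore ''mv'' (Cell (NVar ''x'')) (RArr ''mv'' (Cell (NVar ''y''))))
            (NStore ''ms'' (Cell (NVar ''x'')) (NArr ''ms'' (Cell (NVar ''y'')))))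
       set_min"

definition put_min :: "real \<Rightarrow> nat \<Rightarrow> memory \<Rightarrow> memory" where
  "put_min r b m = m
     \<lparr>rarr := (rarr m)(''mv'' := (rarr m ''mv'')(cell (nvar m ''k'') (nvar m ''a'') (nvar m ''x'') := r)),
      narr := (narr m)(''ms'' := (narr m ''ms'')(cell (nvar m ''k'') (nvar m ''a'') (nvar m ''x'') := b))\<rparr>"

definition block_value :: "memory \<Rightarrow> nat \<Rightarrow> nat \<Rightarrow> real" where
  "block_value m a x = rarr m ''f'' (D_row m a x) + price m a (D_row m a (Suc x))"

text \<open>Like the later rules for program parts, this one accepts any postcondition that holds
  for all times up to a bound, which hides exact step counts from its users.\<close>

lemma wp_set_min:
  assumes "\<And>t. t \<le> 60 \<Longrightarrow>
    Q t (put_min (block_value m (nvar m ''a'') (nvar m ''x'')) (D_row m (nvar m ''a'') (nvar m ''x'')) m)"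
  shows "wp set_min Q m"
  \<comment> \<open>41 is the exact cost of the two stores.\<close>
  using assms[of 41]
  by (simp add: set_min_def wp_simps put_min_def block_value_def D_row_def price_def)

lemma wp_combine_min:
  assumes "\<And>t r b. t \<le> 100 \<Longrightarrow>
      combined (mv_row m (nvar m ''a'') (nvar m ''y'')) (ms_row m (nvar m ''a'') (nvar m ''y''))
        (block_value m (nvar m ''a'') (nvar m ''x'')) (D_row m (nvar m ''a'') (nvar m ''x'')) r b \<Longrightarrow>
      Q t (put_min r b m)"
  shows "wp combine_min Q m"
  unfolding combine_min_def wp_Cond
proof (intro conjI impI)
  assume b: "bval m (RLess (RArr ''mv'' (Cell (NVar ''y''))) (Block_value (NVar ''x'')))"
  show "wp (Seq (RStore ''mv'' (Cell (NVar ''x'')) (RArr ''mv'' (Cell (NVar ''y''))))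
            (NStore ''ms'' (Cell (NVar ''x'')) (NArr ''ms'' (Cell (NVar ''y'')))))
     (\<lambda>t. Q (1 + btime (RLess (RArr ''mv'' (Cell (NVar ''y''))) (Block_value (NVar ''x''))) + t)) m"
    using b assms[of _ "mv_row m (nvar m ''a'') (nvar m ''y'')" "ms_row m (nvar m ''a'') (nvar m ''y'')"]
    by (simp add: wp_simps put_min_def combined_def block_value_def mv_row_def ms_row_def D_row_def price_def)
next
  assume b: "\<not> bval m (RLess (RArr ''mv'' (Cell (NVar ''y''))) (Block_value (NVar ''x'')))"
  show "wp set_min
     (\<lambda>t. Q (1 + btime (RLess (RArr ''mv'' (Cell (NVar ''y''))) (Block_value (NVar ''x''))) + t)) m"
    using b by (intro wp_set_min assms)
      (simp_all add: combined_def block_value_def mv_row_def ms_row_def D_row_def price_def)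
qed

lemma put_min_simps [simp]:
  "nvar (put_min r b m) = nvar m" "rvar (put_min r b m) = rvar m"
  "X \<noteq> ''ms'' \<Longrightarrow> narr (put_min r b m) X = narr m X"
  "X \<noteq> ''mv'' \<Longrightarrow> rarr (put_min r b m) X = rarr m X"
  "D_row (put_min r b m) = D_row m" "price (put_min r b m) = price m"
  "block_value (put_min r b m) = block_value m"
  unfolding put_min_def block_value_def D_row_def price_def by auto

lemma put_min_rows:
  assumes "valid_type m" "b \<in> {1..nvar m ''k''}"
  shows "mv_row (put_min r c m) b = (if b = nvar m ''a'' then (mv_row m b)(nvar m ''x'' := r) else mv_row m b)"
    "ms_row (put_min r c m) b = (if b = nvar m ''a'' then (ms_row m b)(nvar m ''x'' := c) else ms_row m b)"
  using assms by (auto simp: put_min_def mv_row_def ms_row_def row_upd)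

lemma put_min_frame:
  assumes "valid_type m"
  shows "frame m (put_min r c m)" "same_window b m (put_min r c m)" "same_best m (put_min r c m)"
  using assms by (auto simp: frame_def same_defs put_min_rows)

lemma rows_nvar_upd [simp]:
  assumes "z \<noteq> ''k''"
  shows "D_row (m\<lparr>nvar := (nvar m)(z := v)\<rparr>) = D_row m" "mv_row (m\<lparr>nvar := (nvar m)(z := v)\<rparr>) = mv_row m"
    "ms_row (m\<lparr>nvar := (nvar m)(z := v)\<rparr>) = ms_row m" "price (m\<lparr>nvar := (nvar m)(z := v)\<rparr>) = price m"
    "block_value (m\<lparr>nvar := (nvar m)(z := v)\<rparr>) = block_value m"
  using assms by (auto simp: D_row_def mv_row_def ms_row_def price_def block_value_def fun_eq_iff)

lemma rows_narr_upd [simp]: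
  "X \<noteq> ''D'' \<Longrightarrow> D_row (m\<lparr>narr := (narr m)(X := g)\<rparr>) = D_row m"
  "mv_row (m\<lparr>narr := h\<rparr>) = mv_row m"
  "X \<noteq> ''ms'' \<Longrightarrow> ms_row (m\<lparr>narr := (narr m)(X := g)\<rparr>) = ms_row m"
  "price (m\<lparr>narr := h\<rparr>) = price m"
  by (auto simp: D_row_def mv_row_def ms_row_def price_def fun_eq_iff)

lemma rows_rarr_upd [simp]:
  "D_row (m\<lparr>rarr := h\<rparr>) = D_row m"
  "X \<noteq> ''mv'' \<Longrightarrow> mv_row (m\<lparr>rarr := (rarr m)(X := g)\<rparr>) = mv_row m"
  "ms_row (m\<lparr>rarr := h\<rparr>) = ms_row m"
  "X \<noteq> ''cost'' \<Longrightarrow> price (m\<lparr>rarr := (rarr m)(X := g)\<rparr>) = price m"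
  by (auto simp: D_row_def mv_row_def ms_row_def price_def fun_eq_iff)

text \<open>Two stacks of minima with their bottoms at the split: blocks \<open>Suc lo\<close> to
  \<open>mid\<close> form the front, blocks \<open>Suc mid\<close> to \<open>hi - 1\<close> the
  back. Block \<open>lo\<close> belongs to neither, because its left end moves. The minimum of the
  whole front is in cell \<open>Suc lo\<close>, that of the whole back in cell
  \<open>hi - 1\<close>.\<close>

definition minima ::
  "(nat \<Rightarrow> real) \<Rightarrow> (nat \<Rightarrow> real) \<Rightarrow> (nat \<Rightarrow> nat) \<Rightarrow> nat \<Rightarrow> nat \<Rightarrow> nat \<Rightarrow>
     (nat \<Rightarrow> real) \<Rightarrow> (nat \<Rightarrow> nat) \<Rightarrow> bool" where
  "minima f s D lo hi mid mv ms \<longleftrightarrow>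
     (mid = lo \<or> lo < mid \<and> mid < hi) \<and>
     (\<forall>t. lo < t \<and> t \<le> mid \<longrightarrow> ismin f s D (mv t) (ms t) t mid) \<and>
     (\<forall>t. mid < t \<and> t < hi \<longrightarrow> ismin f s D (mv t) (ms t) (Suc mid) t)"

abbreviation minima_of :: "memory \<Rightarrow> nat \<Rightarrow> bool" where
  "minima_of m a \<equiv> minima (rarr m ''f'') (price m a) (D_row m a) (narr m ''lo'' a) (narr m ''hi'' a)
     (narr m ''mid'' a) (mv_row m a) (ms_row m a)"

lemma frame_scratch:
  assumes "z = ''x'' \<or> z = ''y''"
  shows "frame m (m\<lparr>nvar := (nvar m)(z := v)\<rparr>)" "same_window b m (m\<lparr>nvar := (nvar m)(z := v)\<rparr>)"
    "same_best m (m\<lparr>nvar := (nvar m)(z := v)\<rparr>)" "same_minima b m (m\<lparr>nvar := (nvar m)(z := v)\<rparr>)"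
  using assms by (auto simp: frame_def same_defs)

definition halve :: com where
  "halve =
     Seq (NAssign ''x'' Lo) (Seq (NAssign ''y'' Hi)
       (While (NLess (NAdd (NVar ''x'') (NLit 1)) (NVar ''y''))
         (Seq (NAssign ''x'' (NAdd (NVar ''x'') (NLit 1))) (NAssign ''y'' (NSub (NVar ''y'') (NLit 1))))))"

definition fill_front :: com where
  "fill_front =
     Seq set_min
       (While (NLess (NAdd Lo (NLit 1)) (NVar ''x''))
         (Seq (NAssign ''y'' (NVar ''x'')) (Seq (NAssign ''x'' (NSub (NVar ''x'') (NLit 1))) combine_min)))"

definition fill_back :: com where
  "fill_back =
     Seq set_min
       (While (NLess (NAdd (NVar ''x'') (NLit 1)) Hi)
         (Seq (NAssign ''y'' (NVar ''x'')) (Seq (NAssign ''x'' (NAdd (NVar ''x'') (NLit 1))) combine_min)))"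

definition rebuild :: com where
  "rebuild =
     Seq halve (Seq (NStore ''mid'' (NVar ''a'') (NVar ''x'')) (Seq fill_front
       (Seq (NAssign ''x'' (NAdd Mid (NLit 1))) fill_back)))"

text \<open>Leaves free what a repair of the minima touches: scratch variables, the split and the
  stored minima of the current type.\<close>

definition same_frame :: "memory \<Rightarrow> memory \<Rightarrow> bool" where
  "same_frame m m' \<longleftrightarrow> frame m m' \<and> same_window (nvar m ''a'') m m' \<and> same_best m m'"

lemma same_frame_refl [simp]: "same_frame m m"
  unfolding same_frame_def by simp

lemma frame_a: "frame m m' \<Longrightarrow> nvar m' ''a'' = nvar m ''a'' \<and> nvar m' ''k'' = nvar m ''k''"
  unfolding frame_def same_env_def by simp

lemma same_frame_trans: "same_frame m m' \<Longrightarrow> same_frame m' m'' \<Longrightarrow> same_frame m m''"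
  unfolding same_frame_def
  by (intro conjI) (use frame_a[of m m'] in \<open>auto intro: frame_trans same_window_trans same_best_trans\<close>)

lemma same_frame_scratch:
  "z = ''x'' \<or> z = ''y'' \<Longrightarrow> same_frame m (m\<lparr>nvar := (nvar m)(z := v)\<rparr>)"
  unfolding same_frame_def using frame_scratch by simp

lemma same_frame_scratch2:
  "same_frame m (m\<lparr>nvar := (nvar m)(''x'' := u, ''y'' := v)\<rparr>)"
  "same_frame m (m\<lparr>nvar := (nvar m)(''y'' := v, ''x'' := u)\<rparr>)"
  unfolding same_frame_def frame_def same_defs by (simp_all add: D_row_def mv_row_def ms_row_def)

lemma same_frame_put_min: "valid_type m \<Longrightarrow> same_frame m (put_min r c m)"
  unfolding same_frame_def using put_min_frame by simp

lemma same_frame_mid: "same_frame m (m\<lparr>narr := (narr m)(''mid'' := (narr m ''mid'')(nvar m ''a'' := v))\<rparr>)"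
  unfolding same_frame_def frame_def same_defs by simp

lemma same_frameD:
  assumes "same_frame m m'"
  shows "nvar m' ''a'' = nvar m ''a''" "nvar m' ''k'' = nvar m ''k''"
    "narr m' ''lo'' (nvar m ''a'') = narr m ''lo'' (nvar m ''a'')"
    "narr m' ''hi'' (nvar m ''a'') = narr m ''hi'' (nvar m ''a'')"
    "D_row m' (nvar m ''a'') = D_row m (nvar m ''a'')" "price m' = price m"
    "rarr m' ''f'' = rarr m ''f''"
    "block_value m' (nvar m ''a'') = block_value m (nvar m ''a'')"
  using assms frame_price[of m m'] unfolding same_frame_def frame_def same_defs
  by (auto simp: block_value_def fun_eq_iff)

text \<open>The machine has no division of naturals, so the middle is found by two counters walking
  towards each other; this linear cost is of the same order as refilling the minima. The two
  inequalities say that \<open>x\<close> is half of \<open>lo + hi\<close>, rounded down.\<close>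

lemma wp_halve:
  assumes "narr m ''lo'' (nvar m ''a'') \<le> narr m ''hi'' (nvar m ''a'')"
    and Q: "\<And>t m'. same_frame m m' \<Longrightarrow> narr m' ''mid'' = narr m ''mid'' \<Longrightarrow>
      2 * nvar m' ''x'' \<le> narr m ''lo'' (nvar m ''a'') + narr m ''hi'' (nvar m ''a'') \<Longrightarrow>
      narr m ''lo'' (nvar m ''a'') + narr m ''hi'' (nvar m ''a'') \<le> 2 * nvar m' ''x'' + 1 \<Longrightarrow>
      t \<le> 50 * (narr m ''hi'' (nvar m ''a'') - narr m ''lo'' (nvar m ''a'')) + 100 \<Longrightarrow> Q t m'"
  shows "wp halve Q m"
  unfolding halve_def wp_Seq wp_NAssign
proof (rule wp_While[where \<Phi> = "\<lambda>m'. 50 * (nvar m' ''y'' - nvar m' ''x'')" and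
      Inv = "\<lambda>m'. same_frame m m' \<and> narr m' ''mid'' = narr m ''mid'' \<and> nvar m' ''x'' \<le> nvar m' ''y'' \<and>
        nvar m' ''x'' + nvar m' ''y'' = narr m ''lo'' (nvar m ''a'') + narr m ''hi'' (nvar m ''a'')"], goal_cases)
  case 1
  show ?case using assms(1) by (auto intro: same_frame_scratch2)
next
  case (2 m')
  then show ?case
    by (auto simp: wp_simps intro: same_frame_trans[OF _ same_frame_scratch2(1)])
next
  case (3 t m')
  then show ?case by (intro Q) auto
qed

lemma wp_fill_front:
  fixes m :: memory
  defines "a \<equiv> nvar m ''a''"
  assumes "valid_type m" "narr m ''lo'' a \<le> narr m ''mid'' a" "nvar m ''x'' = narr m ''mid'' a"
    and Q: "\<And>t m'. same_frame m m' \<Longrightarrow> narr m' ''mid'' = narr m ''mid'' \<Longrightarrow>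
      (\<forall>t. narr m ''lo'' a < t \<and> t \<le> narr m ''mid'' a \<longrightarrow>
        ismin (rarr m ''f'') (price m a) (D_row m a) (mv_row m' a t) (ms_row m' a t) t (narr m ''mid'' a)) \<Longrightarrow>
      t \<le> 150 * (narr m ''mid'' a - narr m ''lo'' a) + 100 \<Longrightarrow> Q t m'"
  shows "wp fill_front Q m"
proof -
  let ?ok = "\<lambda>m' t. ismin (rarr m ''f'') (price m a) (D_row m a) (mv_row m' a t) (ms_row m' a t) t (narr m ''mid'' a)"
  let ?Inv = "\<lambda>m'. same_frame m m' \<and> narr m' ''mid'' = narr m ''mid'' \<and> narr m ''lo'' a \<le> nvar m' ''x'' \<and>
    nvar m' ''x'' \<le> narr m ''mid'' a \<and> (\<forall>t. nvar m' ''x'' \<le> t \<and> t \<le> narr m ''mid'' a \<longrightarrow> ?ok m' t)"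
  show ?thesis
    unfolding fill_front_def wp_Seq
  proof (rule wp_set_min, rule wp_While[where \<Phi> = "\<lambda>m'. 150 * (nvar m' ''x'' - narr m ''lo'' a)" and Inv = ?Inv],
      goal_cases)
    case (1 t)
    \<comment> \<open>The first store happens even for an empty front; it then hits cell
      \<open>lo\<close>, about which \<open>minima\<close> says nothing.\<close>
    show ?case using assms(2-4) same_frame_put_min[OF assms(2)]
      by (auto simp: put_min_rows a_def block_value_def intro: ismin_single)
  next
    case (2 t m')
    then have fr: "same_frame m m'" by blast
    note eq = same_frameD[OF fr, folded a_def]
    have x: "Suc (narr m ''lo'' a) < nvar m' ''x''" using 2 eq by simp
    define m1 where "m1 = m'\<lparr>nvar := (nvar m')(''y'' := nvar m' ''x'', ''x'' := nvar m' ''x'' - Suc 0)\<rparr>"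
    have m1: "same_frame m m1" unfolding m1_def
      by (rule same_frame_trans[OF fr same_frame_scratch2(2)])
    note eq1 = same_frameD[OF m1, folded a_def]
    have rows1: "mv_row m1 = mv_row m'" "ms_row m1 = ms_row m'" "narr m1 = narr m'"
      by (auto simp: m1_def mv_row_def ms_row_def)
    have xy: "nvar m1 ''y'' = nvar m' ''x''" "nvar m1 ''x'' = nvar m' ''x'' - Suc 0" by (auto simp: m1_def)
    show ?case unfolding wp_Seq wp_NAssign
      apply (simp add: m1_def[symmetric])
      apply (rule wp_combine_min)
      subgoal premises p for t r b
      proof -
        have "same_frame m (put_min r b m1)"
          using same_frame_trans[OF m1 same_frame_put_min] assms(2) eq1 a_def by auto
        moreover have "?ok (put_min r b m1) t" if t: "nvar m' ''x'' - 1 \<le> t" "t \<le> narr m ''mid'' a" for t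
        proof (cases "t = nvar m' ''x'' - 1")
          case True
          have "?ok m' (Suc t)" using 2(2) True x by auto
          then have "ismin (rarr m ''f'') (price m a) (D_row m a) r b t (narr m ''mid'' a)"
            apply (rule ismin_extend_left)
            using p(2) x True eq1 xy rows1 by (simp add: block_value_def)
          then show ?thesis using True assms(2) eq1 xy put_min_rows[of m1 a] by (simp add: a_def[symmetric])
        next
          case False
          then have "?ok m' t" using 2(2) t by auto
          then show ?thesis using False assms(2) eq1 xy rows1 put_min_rows[of m1 a]
            by (simp add: a_def[symmetric])
        qed
        ultimately show ?thesis using p(1) 2 x xy rows1 by auto
      qed
      done
  next
    case (3 t t' m')
    then have fr: "same_frame m m'" by blast
    show ?case
      by (rule Q) (use 3 same_frameD[OF fr, folded a_def] assms(3,4) in auto)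
  qed
qed

text \<open>The back is filled after the front, hence the claim that cells up to \<open>mid\<close>
  survive. The first store goes to \<open>Suc mid\<close>, which may lie outside the deque, where
  nothing is claimed.\<close>

lemma wp_fill_back:
  fixes m :: memory
  defines "a \<equiv> nvar m ''a''"
  assumes "valid_type m" "nvar m ''x'' = Suc (narr m ''mid'' a)"
    and Q: "\<And>t m'. same_frame m m' \<Longrightarrow> narr m' ''mid'' = narr m ''mid'' \<Longrightarrow>
      (\<forall>t \<le> narr m ''mid'' a. mv_row m' a t = mv_row m a t \<and> ms_row m' a t = ms_row m a t) \<Longrightarrow>
      (\<forall>t. narr m ''mid'' a < t \<and> t < narr m ''hi'' a \<longrightarrow>
        ismin (rarr m ''f'') (price m a) (D_row m a) (mv_row m' a t) (ms_row m' a t) (Suc (narr m ''mid'' a)) t) \<Longrightarrow>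
      t \<le> 150 * (narr m ''hi'' a - narr m ''mid'' a) + 100 \<Longrightarrow> Q t m'"
  shows "wp fill_back Q m"
proof -
  let ?ok = "\<lambda>m' t. ismin (rarr m ''f'') (price m a) (D_row m a) (mv_row m' a t) (ms_row m' a t) (Suc (narr m ''mid'' a)) t"
  let ?Inv = "\<lambda>m'. same_frame m m' \<and> narr m' ''mid'' = narr m ''mid'' \<and> narr m ''mid'' a < nvar m' ''x'' \<and>
      (\<forall>t \<le> narr m ''mid'' a. mv_row m' a t = mv_row m a t \<and> ms_row m' a t = ms_row m a t) \<and>
     (\<forall>t. narr m ''mid'' a < t \<and> t \<le> nvar m' ''x'' \<longrightarrow> ?ok m' t)"
  show ?thesis
    unfolding fill_back_def wp_Seq
  proof (rule wp_set_min, rule wp_While[where \<Phi> = "\<lambda>m'. 150 * (narr m ''hi'' a - nvar m' ''x'')" and Inv = ?Inv],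
      goal_cases)
    case (1 t)
    show ?case using assms(2,3) same_frame_put_min[OF assms(2)]
      by (auto simp: put_min_rows a_def block_value_def le_Suc_eq intro: ismin_single)
  next
    case (2 t m')
    then have fr: "same_frame m m'" by blast
    note eq = same_frameD[OF fr, folded a_def]
    have x: "Suc (nvar m' ''x'') < narr m ''hi'' a" using 2 eq by simp
    define m1 where "m1 = m'\<lparr>nvar := (nvar m')(''y'' := nvar m' ''x'', ''x'' := Suc (nvar m' ''x''))\<rparr>"
    have m1: "same_frame m m1" unfolding m1_def
      by (rule same_frame_trans[OF fr same_frame_scratch2(2)])
    note eq1 = same_frameD[OF m1, folded a_def]
    have rows1: "mv_row m1 = mv_row m'" "ms_row m1 = ms_row m'" "narr m1 = narr m'"
      by (auto simp: m1_def mv_row_def ms_row_def)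
    have xy: "nvar m1 ''y'' = nvar m' ''x''" "nvar m1 ''x'' = Suc (nvar m' ''x'')" by (auto simp: m1_def)
    show ?case unfolding wp_Seq wp_NAssign
      apply (simp add: m1_def[symmetric])
      apply (rule wp_combine_min)
      subgoal premises p for t r b
      proof -
        have "same_frame m (put_min r b m1)"
          using same_frame_trans[OF m1 same_frame_put_min] assms(2) eq1 a_def by auto
        moreover have "?ok (put_min r b m1) t" if t: "narr m ''mid'' a < t" "t \<le> Suc (nvar m' ''x'')" for t
        proof (cases "t = Suc (nvar m' ''x'')")
          case True
          have "?ok m' (nvar m' ''x'')" using 2(2) by auto
          then have "ismin (rarr m ''f'') (price m a) (D_row m a) r b (Suc (narr m ''mid'' a)) (Suc (nvar m' ''x''))"
            apply (rule ismin_extend_right)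
            using p(2) eq1 xy rows1 by (simp add: block_value_def)
          then show ?thesis using True assms(2) eq1 xy put_min_rows[of m1 a] by (simp add: a_def[symmetric])
        next
          case False
          then have "?ok m' t" using 2(2) t by auto
          then show ?thesis using False assms(2) eq1 xy rows1 put_min_rows[of m1 a]
            by (simp add: a_def[symmetric])
        qed
        moreover have "mv_row (put_min r b m1) a t = mv_row m a t \<and> ms_row (put_min r b m1) a t = ms_row m a t"
          if "t \<le> narr m ''mid'' a" for t
          using that 2(2) assms(2) eq1 xy rows1 put_min_rows[of m1 a] by (auto simp: a_def[symmetric])
        ultimately show ?thesis using p(1) 2 x xy rows1 by auto
      qed
      done
  next
    case (3 t t' m')
    then have fr: "same_frame m m'" by blast
    show ?case
      by (rule Q) (use 3 same_frameD[OF fr, folded a_def] assms(3) in auto)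
  qed
qed


text \<open>Rounding down gives the split its admissible position: \<open>mid = lo\<close> if there
  is at most one block, strictly inside otherwise. The bounds on \<open>mid\<close> are passed on
  because they limit the new imbalance to 1.\<close>

lemma wp_rebuild:
  fixes m :: memory
  defines "a \<equiv> nvar m ''a''"
  assumes va: "valid_type m" and le: "narr m ''lo'' a \<le> narr m ''hi'' a"
    and Q: "\<And>t m'. same_frame m m' \<Longrightarrow> minima_of m' a \<Longrightarrow>
      2 * narr m' ''mid'' a \<le> narr m ''lo'' a + narr m ''hi'' a \<Longrightarrow>
      narr m ''lo'' a + narr m ''hi'' a \<le> 2 * narr m' ''mid'' a + 1 \<Longrightarrow>
      t \<le> 400 * (narr m ''hi'' a - narr m ''lo'' a) + 400 \<Longrightarrow> Q t m'"
  shows "wp rebuild Q m"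
  unfolding rebuild_def wp_Seq
proof (rule wp_halve, goal_cases)
  case 1
  show ?case using le a_def by simp
next
  case (2 t1 m1)
  note e1 = same_frameD[OF 2(1), folded a_def]
  define m2 where "m2 = m1\<lparr>narr := (narr m1)(''mid'' := (narr m1 ''mid'')(a := nvar m1 ''x''))\<rparr>"
  have f2: "same_frame m m2" unfolding m2_def
    by (rule same_frame_trans[OF 2(1)]) (use same_frame_mid[of m1] e1 in simp)
  note e2 = same_frameD[OF f2, folded a_def]
  have x2: "nvar m2 ''x'' = nvar m1 ''x''" "narr m2 ''mid'' a = nvar m1 ''x''" by (auto simp: m2_def)
  show ?case
    apply (simp add: wp_NStore e1 m2_def[symmetric])
  proof (rule wp_fill_front, goal_cases)
    case 1 show ?case using va e2 a_def by simp
  next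
    case 2 show ?case using \<open>_ \<le> 2 * nvar m1 ''x'' + 1\<close> e2 x2 le by (simp add: a_def)
  next
    case 3 show ?case using e2 x2 by simp
  next
    case (4 t3 m3)
    have f3: "same_frame m m3" by (rule same_frame_trans[OF f2 4(1)])
    note e3 = same_frameD[OF f3, folded a_def]
    define m4 where "m4 = m3\<lparr>nvar := (nvar m3)(''x'' := Suc (narr m3 ''mid'' a))\<rparr>"
    have f4: "same_frame m m4" unfolding m4_def
      by (rule same_frame_trans[OF f3 same_frame_scratch]) simp
    note e4 = same_frameD[OF f4, folded a_def]
    show ?case
      apply (simp add: wp_NAssign e3 m4_def[symmetric])
    proof (rule wp_fill_back, goal_cases)
      case 1 show ?case using va e4 a_def by simp
    next
      case 2 show ?case using e4 by (simp add: m4_def)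
    next
      case (3 t5 m5)
      have f5: "same_frame m m5" by (rule same_frame_trans[OF f4 3(1)])
      note e5 = same_frameD[OF f5, folded a_def]
      have mid: "narr m5 ''mid'' a = nvar m1 ''x''" "narr m4 ''mid'' a = nvar m1 ''x''"
        using 3(2) 4(2) x2 by (auto simp: m4_def)
      have rows: "mv_row m4 = mv_row m3" "ms_row m4 = ms_row m3" by (auto simp: m4_def)
      have bal: "2 * nvar m1 ''x'' \<le> narr m ''lo'' a + narr m ''hi'' a"
        "narr m ''lo'' a + narr m ''hi'' a \<le> 2 * nvar m1 ''x'' + 1"
        using 2(3,4) a_def by auto
      have "minima_of m5 a"
        using 3(3,4) 4(3) bal le unfolding minima_def e5 e4 e2 mid rows x2 by auto
      moreover have "t1 \<le> 50 * (narr m ''hi'' a - narr m ''lo'' a) + 100"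
        "t3 \<le> 150 * (nvar m1 ''x'' - narr m ''lo'' a) + 100"
        "t5 \<le> 150 * (narr m ''hi'' a - nvar m1 ''x'') + 100"
        using 2(5) 4(4) 3(5) e2 e4 mid x2 a_def by auto
      moreover have "narr m ''lo'' a \<le> nvar m1 ''x''" "nvar m1 ''x'' \<le> narr m ''hi'' a"
        using bal le by linarith+
      ultimately show ?case
        by (intro Q f5) (use bal mid in simp_all)
    qed
  qed
qed

section \<open>Sliding the window\<close>

definition wsum :: "(nat \<Rightarrow> real) \<Rightarrow> nat \<Rightarrow> nat \<Rightarrow> real" where
  "wsum w l j = sum w {Suc l..j}"

text \<open>The last clause declares the discarded starts too heavy; it stays true for growing
  \<open>j\<close> because weights are nonnegative. That \<open>L\<close> itself is light enough is
  kept out, since a new job may violate it until the window has been shrunk.\<close>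

definition window :: "memory \<Rightarrow> nat \<Rightarrow> nat \<Rightarrow> bool" where
  "window m a j \<longleftrightarrow>
     deque (price m a) (D_row m a) (narr m ''lo'' a) (narr m ''hi'' a) \<and>
     D_row m a (narr m ''lo'' a) = narr m ''L'' a \<and> D_row m a (narr m ''hi'' a) = j \<and>
     rarr m ''S'' a = wsum (rarr m ''weight'') (narr m ''L'' a) j \<and>
     (\<forall>l < narr m ''L'' a. rarr m ''threshold'' a < wsum (rarr m ''weight'') l j)"

text \<open>While the ends of the deque move, the stored minima are only usable if the split position
  \<open>mid\<close> is still inside; the minimum for the newest block is not yet known.\<close>

definition partial_minima ::
  "(nat \<Rightarrow> real) \<Rightarrow> (nat \<Rightarrow> real) \<Rightarrow> (nat \<Rightarrow> nat) \<Rightarrow> nat \<Rightarrow> nat \<Rightarrow> nat \<Rightarrow>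
     (nat \<Rightarrow> real) \<Rightarrow> (nat \<Rightarrow> nat) \<Rightarrow> bool" where
  "partial_minima f s D lo hi mid mv ms \<longleftrightarrow>
     (lo < mid \<and> Suc mid < hi \<longrightarrow> (\<forall>t. lo < t \<and> t \<le> mid \<longrightarrow> ismin f s D (mv t) (ms t) t mid)) \<and>
     (lo \<le> mid \<longrightarrow> (\<forall>t. mid < t \<and> Suc t < hi \<longrightarrow> ismin f s D (mv t) (ms t) (Suc mid) t))"

abbreviation partial_minima_of :: "memory \<Rightarrow> nat \<Rightarrow> bool" where
  "partial_minima_of m a \<equiv> partial_minima (rarr m ''f'') (price m a) (D_row m a) (narr m ''lo'' a)
     (narr m ''hi'' a) (narr m ''mid'' a) (mv_row m a) (ms_row m a)"

text \<open>Only \<open>D (Suc h)\<close> changes, and block \<open>x\<close> reads \<open>D\<close>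
  up to \<open>Suc x\<close>, so minima of ranges ending below \<open>h\<close> survive. For the new
  right index \<open>Suc h\<close> this is what the guards \<open>Suc mid < hi\<close> and
  \<open>Suc t < hi\<close> in \<open>partial_minima\<close> express.\<close>

lemma partial_minima_push:
  assumes "minima f s D lo hi mid mv ms" "h \<le> hi"
  shows "partial_minima f s (D(Suc h := j)) lo (Suc h) mid mv ms"
  using assms unfolding minima_def partial_minima_def
  by (auto elim!: ismin_cong)

lemma partial_minima_pop_left:
  "partial_minima f s D lo hi mid mv ms \<Longrightarrow> partial_minima f s D (Suc lo) hi mid mv ms"
  unfolding partial_minima_def by auto

text \<open>Within the deque \<open>D lo\<close> enters only the value of block \<open>lo\<close>,
  which no usable stored minimum covers.\<close>

lemma partial_minima_shrink_left:
  "partial_minima f s D lo hi mid mv ms \<Longrightarrow> partial_minima f s (D(lo := l)) lo hi mid mv ms"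
  unfolding partial_minima_def by (auto elim!: ismin_cong)

lemma minima_extend:
  assumes "partial_minima f s D lo hi mid mv ms" "mid = lo \<or> lo < mid \<and> Suc mid < hi"
    and "\<And>t. Suc t < hi \<Longrightarrow> mv' t = mv t \<and> ms' t = ms t"
    and "mid < hi - 1 \<Longrightarrow> ismin f s D (mv' (hi - 1)) (ms' (hi - 1)) (Suc mid) (hi - 1)"
  shows "minima f s D lo hi mid mv' ms'"
proof -
  have "ismin f s D (mv' t) (ms' t) (Suc mid) t" if "mid < t" "t < hi" for t
  proof (cases "Suc t = hi")
    case True
    then show ?thesis using assms(4) that by auto
  next
    case False
    then show ?thesis using assms(1-3) that unfolding partial_minima_def by auto
  qed
  then show ?thesis using assms(1-3) unfolding partial_minima_def minima_def by auto
qed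

text \<open>The two truncated differences add up to the absolute value of
  \<open>2 * mid - (lo + hi)\<close>. Moving an end of the deque by one changes it by 1 and so costs
  at most 1000; a leaving entry releases 2000, so that 1000 remain for its removal. The 3000 per job
  in the window pay for the steps of \<open>L\<close>, and 1000 per unit of imbalance exceed the 400
  per block of a rebuild.\<close>

definition pot :: "memory \<Rightarrow> nat \<Rightarrow> nat \<Rightarrow> nat" where
  "pot m a j = 3000 * (j - narr m ''L'' a) + 2000 * (narr m ''hi'' a - narr m ''lo'' a) +
     1000 * ((2 * narr m ''mid'' a - (narr m ''lo'' a + narr m ''hi'' a)) +
       ((narr m ''lo'' a + narr m ''hi'' a) - 2 * narr m ''mid'' a))"

section \<open>Moving the right end of the window\<close>

definition pop_right :: com where
  "pop_right =
     While (Conj (NLess Lo Hi) (Neg (RLess (Price (NVar ''j'')) (Price (D_at Hi)))))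
       (NStore ''hi'' (NVar ''a'') (NSub Hi (NLit 1)))"

definition push_job :: com where
  "push_job =
     Seq (RStore ''S'' (NVar ''a'') (RAdd (RArr ''S'' (NVar ''a'')) (RArr ''weight'' (NVar ''j''))))
    (Seq pop_right
    (Seq (NStore ''hi'' (NVar ''a'') (NAdd Hi (NLit 1)))
         (NStore ''D'' (Cell Hi) (NVar ''j''))))"

lemma window_L_le: "window m a j \<Longrightarrow> narr m ''L'' a \<le> j"
  using deque_less[of "price m a" "D_row m a" "narr m ''lo'' a" "narr m ''hi'' a" "narr m ''lo'' a" "narr m ''hi'' a"]
  unfolding window_def by (cases "narr m ''lo'' a = narr m ''hi'' a") (auto simp: deque_def)

definition set_hi :: "nat \<Rightarrow> memory \<Rightarrow> memory" where
  "set_hi h m = m\<lparr>narr := (narr m)(''hi'' := (narr m ''hi'')(nvar m ''a'' := h))\<rparr>"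

lemma set_hi_simps [simp]:
  "nvar (set_hi h m) = nvar m" "rvar (set_hi h m) = rvar m" "rarr (set_hi h m) = rarr m"
  "X \<noteq> ''hi'' \<Longrightarrow> narr (set_hi h m) X = narr m X"
  "narr (set_hi h m) ''hi'' = (narr m ''hi'')(nvar m ''a'' := h)"
  "D_row (set_hi h m) = D_row m" "mv_row (set_hi h m) = mv_row m" "ms_row (set_hi h m) = ms_row m"
  "price (set_hi h m) = price m" "set_hi h' (set_hi h m) = set_hi h' m"
  unfolding set_hi_def by simp_all

text \<open>The loop changes nothing but \<open>hi\<close>, so every state is
  \<open>set_hi h m\<close> and all facts can be stated about the original row \<open>D\<close>.
  Entries equal to the new price are popped too, which keeps the maxima strictly decreasing.\<close>

lemma wp_pop_right:
  fixes m :: memory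
  defines "a \<equiv> nvar m ''a''" and "j \<equiv> nvar m ''j''"
  defines "s \<equiv> price m a" and "D \<equiv> D_row m a" and "lo \<equiv> narr m ''lo'' a" and "hi \<equiv> narr m ''hi'' a"
  assumes dq: "deque s D lo hi" and j: "j = Suc (D hi)"
    and Q: "\<And>t h. deque s D lo h \<Longrightarrow> h \<le> hi \<Longrightarrow> D h < j \<Longrightarrow> (lo < h \<Longrightarrow> s j < s (D h)) \<Longrightarrow>
       (\<And>x. D h < x \<Longrightarrow> x < j \<Longrightarrow> s x \<le> s j) \<Longrightarrow>
       t \<le> 1000 * (hi - h) + 100 \<Longrightarrow> Q t (set_hi h m)"
  shows "wp pop_right Q m"
  unfolding pop_right_def
proof (rule wp_While[where \<Phi> = "\<lambda>m'. 1000 * narr m' ''hi'' a" and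
    Inv = "\<lambda>m'. \<exists>h. m' = set_hi h m \<and> deque s D lo h \<and> h \<le> hi \<and> D h < j \<and>
      (\<forall>x. D h < x \<longrightarrow> x < j \<longrightarrow> s x \<le> s j)"], goal_cases)
  case 1
  have "m = set_hi hi m" unfolding set_hi_def hi_def a_def by simp
  then show ?case using dq j by (intro exI[of _ hi]) auto
next
  case (2 m')
  then obtain h where h: "m' = set_hi h m" "deque s D lo h" "h \<le> hi" "D h < j"
    "\<forall>x. D h < x \<longrightarrow> x < j \<longrightarrow> s x \<le> s j" by blast
  have b: "lo < h" "s (D h) \<le> s j"
    using 2(2) unfolding h(1)
    by (simp_all add: a_def j_def s_def D_def lo_def price_def D_row_def)
  have "D (h - Suc 0) < D h" using deque_less[OF h(2), of "h - Suc 0" h] b h(2) unfolding deque_def by auto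
  \<comment> \<open>The jobs of the popped block are bounded by its maximum, which the loop guard
    bounds by \<open>s j\<close>.\<close>
  moreover have "s x \<le> s j" if "D (h - Suc 0) < x" "x < j" for x
  proof (cases "D h < x")
    case False
    then have "s x \<le> s (D h)"
      using h(2) b(1) that unfolding deque_def
      by (metis Suc_pred' leI le_less_Suc_eq less_Suc_eq_le not_less_zero gr0I One_nat_def lessI Suc_leI)
    then show ?thesis using b by simp
  qed (use h that in auto)
  moreover have "deque s D lo (h - Suc 0)" using deque_pop_right[OF h(2) b(1)] .
  moreover have "set_hi (h - Suc 0) m = m'\<lparr>narr := (narr m')(''hi'' := (narr m' ''hi'')(nvar m' ''a'' := h - Suc 0))\<rparr>"
    unfolding h(1) set_hi_def by simp
  ultimately show ?case
    using h b by (auto simp: wp_NStore a_def intro!: exI[of _ "h - Suc 0"])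
next
  case (3 t m')
  then obtain h where h: "m' = set_hi h m" "deque s D lo h" "h \<le> hi" "D h < j"
    "\<forall>x. D h < x \<longrightarrow> x < j \<longrightarrow> s x \<le> s j" by blast
  have "s j < s (D h)" if "lo < h"
    using 3(2) that unfolding h(1)
    by (simp add: a_def j_def s_def D_def lo_def price_def D_row_def)
  then show ?case unfolding h(1) using h 3(3) by (intro Q) (auto simp: hi_def a_def)
qed

lemma wp_push_job:
  fixes m :: memory
  defines "a \<equiv> nvar m ''a''" and "j \<equiv> nvar m ''j''"
  assumes va: "valid_type m" and j: "0 < j" and w: "0 \<le> rarr m ''weight'' j"
    and win: "window m a (j - 1)" and mins: "minima_of m a"
    and Q: "\<And>t m'. frame m m' \<Longrightarrow> same_best m m' \<Longrightarrow> window m' a j \<Longrightarrow> partial_minima_of m' a \<Longrightarrow>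
      t + pot m' a j \<le> pot m a (j - 1) + 10000 \<Longrightarrow> Q t m'"
  shows "wp push_job Q m"
proof -
  define s D lo hi where "s = price m a" and "D = D_row m a" and "lo = narr m ''lo'' a" and "hi = narr m ''hi'' a"
  define m1 where "m1 = m\<lparr>rarr := (rarr m)(''S'' := (rarr m ''S'')(a := rarr m ''S'' a + rarr m ''weight'' j))\<rparr>"
  have m1: "nvar m1 = nvar m" "narr m1 = narr m" "price m1 = price m" "D_row m1 = D_row m"
    "mv_row m1 = mv_row m" "ms_row m1 = ms_row m" "rvar m1 = rvar m"
    "rarr m1 ''weight'' = rarr m ''weight''" "rarr m1 ''f'' = rarr m ''f''"
    "rarr m1 ''threshold'' = rarr m ''threshold''" "rarr m1 ''cost'' = rarr m ''cost''"
    "rarr m1 ''mv'' = rarr m ''mv''"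
    "rarr m1 ''S'' = (rarr m ''S'')(a := rarr m ''S'' a + rarr m ''weight'' j)"
    by (simp_all add: m1_def)
  have W: "wsum (rarr m ''weight'') l j = wsum (rarr m ''weight'') l (j - 1) + rarr m ''weight'' j" if "l < j" for l
  proof -
    obtain i where "j = Suc i" using j by (cases j) auto
    then show ?thesis using that by (simp add: wsum_def)
  qed
  have L: "narr m ''L'' a \<le> j - 1" using window_L_le[OF win] .
  show ?thesis
    unfolding push_job_def wp_Seq wp_RStore
    apply (simp add: a_def[symmetric] j_def[symmetric] m1_def[symmetric])
  proof (rule wp_pop_right, goal_cases)
    case 1
    show ?case using win by (simp add: m1 a_def[symmetric] window_def)
  next
    case 2
    show ?case using win j by (simp add: m1 a_def[symmetric] j_def[symmetric] window_def)
  next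
    case (3 t h)
    note p = 3[unfolded m1, folded a_def j_def, folded s_def D_def lo_def hi_def]
    define m2 where "m2 = m1\<lparr>narr := (narr m1)(''hi'' := (narr m ''hi'')(a := Suc h),
       ''D'' := (narr m ''D'')(cell (nvar m ''k'') a (Suc h) := j))\<rparr>"
    have m2: "nvar m2 = nvar m1" "rarr m2 = rarr m1" "rvar m2 = rvar m1" "price m2 = price m1"
      "mv_row m2 = mv_row m1" "ms_row m2 = ms_row m1"
      "narr m2 = (narr m)(''hi'' := (narr m ''hi'')(a := Suc h),
         ''D'' := (narr m ''D'')(cell (nvar m ''k'') a (Suc h) := j))"
      by (auto simp: m2_def m1 price_def mv_row_def ms_row_def fun_eq_iff)
    have rows: "D_row m2 b = (if b = a then D(Suc h := j) else D_row m b)" if "b \<in> {1..nvar m ''k''}" for b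
      using va that by (auto simp: D_row_def m2 m1 D_def row_upd a_def)
    have lo_h: "lo \<le> h" using p(1) unfolding deque_def by blast
    have a: "a \<in> {1..nvar m ''k''}" using va a_def by simp
    have "deque s (D(Suc h := j)) lo (Suc h)"
      using deque_push[of s D lo h j] p by auto
    moreover have "\<forall>l<narr m ''L'' a. rarr m ''threshold'' a < wsum (rarr m ''weight'') l j"
    proof (intro allI impI)
      fix l assume "l < narr m ''L'' a"
      then have "rarr m ''threshold'' a < wsum (rarr m ''weight'') l (j - 1)" "l < j"
        using win L unfolding window_def by auto
      then show "rarr m ''threshold'' a < wsum (rarr m ''weight'') l j" using W w by simp
    qed
    ultimately have "window m2 a j"
      using win W[of "narr m ''L'' a"] L j a lo_h
      by (auto simp: window_def rows m2 m1 s_def lo_def D_def)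
    moreover have "partial_minima_of m2 a"
      using partial_minima_push[OF mins[folded lo_def hi_def s_def D_def] p(2), of j] a
      by (simp add: rows m2 m1 s_def lo_def)
    moreover have "frame m m2" "same_best m m2"
      using a by (auto simp: frame_def same_defs rows m2 m1 a_def[symmetric])
    \<comment> \<open>The new job adds 3000 for the window, 2000 for its entry and at most 1000 for
      the imbalance. Each pop releases at least 1000, which is what its iteration is
      charged.\<close>
    moreover have "t + 100 + pot m2 a j \<le> pot m a (j - 1) + 10000"
      using p(2,6) L lo_h j unfolding pot_def m2 by (simp add: lo_def hi_def) arith
    ultimately have "Q (t' + t) m2" if "t' \<le> 100" for t'
      using that by (intro Q) auto
    \<comment> \<open>21 is the exact cost of the three stores around
      \<open>pop_right\<close>.\<close>
    from this[of 21] show ?case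
      unfolding wp_NStore
      by (simp add: m1 a_def[symmetric] j_def[symmetric] add.commute add.left_commute fun_upd_upd
        set_hi_def m2_def[unfolded m1] m2_def)
  qed
qed


section \<open>Moving the left end of the window\<close>

definition shrink_window :: com where
  "shrink_window =
     While (RLess (RArr ''threshold'' (NVar ''a'')) (RArr ''S'' (NVar ''a'')))
       (Seq (NStore ''L'' (NVar ''a'') (NAdd Left (NLit 1)))
       (Seq (RStore ''S'' (NVar ''a'') (RSub (RArr ''S'' (NVar ''a'')) (RArr ''weight'' Left)))
         (Cond (NEq (D_at (NAdd Lo (NLit 1))) Left)
           (NStore ''lo'' (NVar ''a'') (NAdd Lo (NLit 1)))
           (NStore ''D'' (Cell Lo) Left))))"

lemma window_nonempty:
  assumes "window m a j" "narr m ''L'' a < j"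
  shows "narr m ''lo'' a < narr m ''hi'' a"
  using assms unfolding window_def deque_def by (metis le_neq_implies_less nat_neq_iff)

text \<open>Each iteration advances \<open>L\<close> by one, dropping the first block if this
  exhausts it and otherwise cutting one start off it. The 3000 released by \<open>L\<close> pay for
  it; the imbalance changes only when an entry leaves, and the 2000 released then outweigh
  that.\<close>

lemma wp_shrink_window:
  fixes m :: memory
  defines "a \<equiv> nvar m ''a''"
  assumes va: "valid_type m" and th: "0 \<le> rarr m ''threshold'' a"
    and win: "window m a j" and mins: "partial_minima_of m a"
    and Q: "\<And>t m'. frame m m' \<Longrightarrow> same_best m m' \<Longrightarrow> window m' a j \<Longrightarrow> partial_minima_of m' a \<Longrightarrow>
      rarr m' ''S'' a \<le> rarr m' ''threshold'' a \<Longrightarrow>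
      t + pot m' a j \<le> pot m a j + 100 \<Longrightarrow> Q t m'"
  shows "wp shrink_window Q m"
  unfolding shrink_window_def
proof (rule wp_While[where \<Phi> = "\<lambda>m'. pot m' a j" and
    Inv = "\<lambda>m'. frame m m' \<and> same_best m m' \<and> window m' a j \<and> partial_minima_of m' a"], goal_cases)
  case 1
  show ?case using win mins by simp
next
  case (3 t m')
  have "nvar m' ''a'' = a" using 3(1) unfolding frame_def same_env_def a_def by simp
  with 3 show ?case by (intro Q) auto
next
  case (2 m')
  then have fr: "frame m m'" and best: "same_best m m'" and win': "window m' a j"
    and mins': "partial_minima_of m' a" by auto
  have env: "nvar m' ''a'' = a" "nvar m' ''k'' = nvar m ''k''" "rarr m' ''threshold'' = rarr m ''threshold''"
    using fr unfolding frame_def same_env_def a_def by auto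
  have a: "a \<in> {1..nvar m' ''k''}" using va a_def env by simp
  define l lo hi D where "l = narr m' ''L'' a" and "lo = narr m' ''lo'' a" and "hi = narr m' ''hi'' a" and "D = D_row m' a"
  have guard: "rarr m' ''threshold'' a < wsum (rarr m' ''weight'') l j"
    using 2 win' env unfolding window_def l_def by simp
  \<comment> \<open>With \<open>l = j\<close> the window would have weight 0, which no nonnegative
    threshold forbids.\<close>
  have "l < j"
  proof (rule ccontr)
    assume "\<not> l < j"
    then show False using guard th env by (simp add: wsum_def)
  qed
  then have lohi: "lo < hi" using window_nonempty[OF win'] by (simp add: l_def lo_def hi_def)
  have dq: "deque (price m' a) D lo hi" "D lo = l" "D hi = j"
    using win' unfolding window_def D_def lo_def hi_def l_def by auto
  have lD: "l < D (Suc lo)" using dq lohi unfolding deque_def by auto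
  have W: "wsum (rarr m' ''weight'') l j = rarr m' ''weight'' (Suc l) + wsum (rarr m' ''weight'') (Suc l) j"
    using \<open>l < j\<close> unfolding wsum_def by (simp add: sum.atLeast_Suc_atMost)
  define m1 where "m1 = m'\<lparr>narr := (narr m')(''L'' := (narr m' ''L'')(a := Suc l)),
    rarr := (rarr m')(''S'' := (rarr m' ''S'')(a := rarr m' ''S'' a - rarr m' ''weight'' (Suc l)))\<rparr>"
  have m1: "nvar m1 = nvar m'" "narr m1 = (narr m')(''L'' := (narr m' ''L'')(a := Suc l))"
    "rarr m1 = (rarr m')(''S'' := (rarr m' ''S'')(a := rarr m' ''S'' a - rarr m' ''weight'' (Suc l)))"
    "price m1 = price m'" "D_row m1 = D_row m'" "mv_row m1 = mv_row m'" "ms_row m1 = ms_row m'"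
    "rvar m1 = rvar m'"
    by (auto simp: m1_def D_row_def mv_row_def ms_row_def price_def fun_eq_iff)
  define m2 where "m2 = (if D (Suc lo) = Suc l
     then m1\<lparr>narr := (narr m1)(''lo'' := (narr m1 ''lo'')(a := Suc lo))\<rparr>
     else m1\<lparr>narr := (narr m1)(''D'' := (narr m1 ''D'')(cell (nvar m' ''k'') a lo := Suc l))\<rparr>)"
  have m2: "nvar m2 = nvar m1" "rarr m2 = rarr m1" "rvar m2 = rvar m1" "price m2 = price m1"
    "mv_row m2 = mv_row m1" "ms_row m2 = ms_row m1"
    "X \<noteq> ''lo'' \<Longrightarrow> X \<noteq> ''D'' \<Longrightarrow> narr m2 X = narr m1 X"
    "narr m2 ''lo'' = (if D (Suc lo) = Suc l then (narr m' ''lo'')(a := Suc lo) else narr m' ''lo'')" for X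
    by (auto simp: m2_def m1 price_def mv_row_def ms_row_def fun_eq_iff)
  have rows: "D_row m2 b = (if b = a \<and> D (Suc lo) \<noteq> Suc l then D(lo := Suc l) else D_row m' b)"
    if "b \<in> {1..nvar m' ''k''}" for b
    using a that by (auto simp: D_row_def m2_def m1 D_def row_upd)
  have dq2: "deque (price m' a) (D_row m2 a) (narr m2 ''lo'' a) hi"
    "D_row m2 a (narr m2 ''lo'' a) = Suc l" "D_row m2 a hi = j"
    using deque_pop_left[OF dq(1) lohi] deque_shrink_left[OF dq(1), of "Suc l"] dq(2,3) lD lohi a
    by (auto simp: m2 m1 rows lo_def D_def)
  \<comment> \<open>The loop guard itself says that the start \<open>l\<close> now given up is too
    heavy.\<close>
  have "\<forall>i<Suc l. rarr m' ''threshold'' a < wsum (rarr m' ''weight'') i j"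
    using guard win' unfolding window_def l_def by (auto simp: less_Suc_eq)
  then have "window m2 a j"
    using dq2 win' W unfolding window_def by (simp add: m2 m1 hi_def[symmetric] l_def[symmetric])
  moreover have "partial_minima_of m2 a"
    using partial_minima_pop_left[OF mins'] partial_minima_shrink_left[OF mins', of "Suc l"] mins' a
    by (auto simp: rows m2 m1 lo_def D_def)
  moreover have "frame m' m2" "same_best m' m2"
    using a env by (auto simp: frame_def same_defs rows m2 m1)
  moreover have "pot m2 a j + 500 \<le> pot m' a j"
    using \<open>l < j\<close> lohi unfolding pot_def m2 m1 by (simp add: lo_def hi_def l_def m2 m1) arith
  ultimately have
    "wp (Cond (NEq (D_at (NAdd Lo (NLit 1))) Left)
           (NStore ''lo'' (NVar ''a'') (NAdd Lo (NLit 1)))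
           (NStore ''D'' (Cell Lo) Left))
      (\<lambda>t x. t \<le> 100 \<and> (frame m x \<and> same_best m x \<and> window x a j \<and> partial_minima_of x a) \<and>
         pot x a j + 500 \<le> pot m' a j) m1"
    using frame_trans[OF fr] same_best_trans[OF best] env
    by (auto simp: wp_simps m1 m2_def D_def lo_def l_def D_row_def)
  then have "wp (Cond (NEq (D_at (NAdd Lo (NLit 1))) Left)
           (NStore ''lo'' (NVar ''a'') (NAdd Lo (NLit 1)))
           (NStore ''D'' (Cell Lo) Left))
      (\<lambda>t x. (frame m x \<and> same_best m x \<and> window x a j \<and> partial_minima_of x a) \<and>
         t + 50 + pot x a j \<le> pot m' a j) m1"
    by (rule wp_mono) auto
  then show ?case
    unfolding wp_Seq wp_NStore wp_RStore
    by (simp add: env m1_def l_def) (erule wp_mono, simp)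
qed

section \<open>Restoring the running minima\<close>

definition extend_minima :: com where
  "extend_minima =
     Seq (NAssign ''x'' (NSub Hi (NLit 1)))
       (Cond (NLess Mid (NVar ''x''))
         (Cond (NEq (NVar ''x'') (NAdd Mid (NLit 1))) set_min
           (Seq (NAssign ''y'' (NSub (NVar ''x'') (NLit 1))) combine_min))
         Skip)"

definition repair :: com where
  "repair =
     Cond (NEq Lo Mid) extend_minima
       (Cond (Conj (NLess Lo Mid) (NLess (NAdd Mid (NLit 1)) Hi)) extend_minima rebuild)"

text \<open>Only the newest block \<open>hi - 1\<close> lacks its minimum. It opens the back if it
  equals \<open>Suc mid\<close> and extends the back if it is larger; otherwise
  \<open>mid = lo\<close> and there is at most the block \<open>lo\<close>, which is kept apart
  anyway.\<close>

lemma wp_extend_minima: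
  fixes m :: memory
  defines "a \<equiv> nvar m ''a''"
  assumes va: "valid_type m" and mins: "partial_minima_of m a"
    and split: "narr m ''mid'' a = narr m ''lo'' a \<or>
      narr m ''lo'' a < narr m ''mid'' a \<and> Suc (narr m ''mid'' a) < narr m ''hi'' a"
    and Q: "\<And>t m'. same_frame m m' \<Longrightarrow> narr m' ''mid'' = narr m ''mid'' \<Longrightarrow> minima_of m' a \<Longrightarrow>
      t \<le> 300 \<Longrightarrow> Q t m'"
  shows "wp extend_minima Q m"
proof -
  define hi mid where "hi = narr m ''hi'' a" and "mid = narr m ''mid'' a"
  define m1 where "m1 = m\<lparr>nvar := (nvar m)(''x'' := hi - Suc 0)\<rparr>"
  define m2 where "m2 = m1\<lparr>nvar := (nvar m1)(''y'' := hi - Suc (Suc 0))\<rparr>"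
  have f1: "same_frame m m1" unfolding m1_def by (rule same_frame_scratch) simp
  have f2: "same_frame m m2" unfolding m2_def
    by (rule same_frame_trans[OF f1 same_frame_scratch]) simp
  note e1 = same_frameD[OF f1, folded a_def] and e2 = same_frameD[OF f2, folded a_def]
  have rows: "mv_row m1 = mv_row m" "ms_row m1 = ms_row m" "mv_row m2 = mv_row m" "ms_row m2 = ms_row m"
    "narr m1 = narr m" "narr m2 = narr m" "nvar m1 ''x'' = hi - Suc 0" "nvar m2 ''x'' = hi - Suc 0"
    "nvar m2 ''y'' = hi - Suc (Suc 0)"
    by (auto simp: m1_def m2_def mv_row_def ms_row_def)
  have a: "a \<in> {1..nvar m ''k''}" using va a_def by simp
  have f: "same_frame m (put_min r b m')" if "m' = m1 \<or> m' = m2" for r b m'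
    using same_frame_trans[OF f1 same_frame_put_min] same_frame_trans[OF f2 same_frame_put_min]
      that a e1 e2 by auto
  have fin: "minima_of (put_min r b m') a"
    if "m' = m1 \<or> m' = m2" "ismin (rarr m ''f'') (price m a) (D_row m a) r b (Suc mid) (hi - 1)" for r b m'
  proof -
    note e = same_frameD[OF f[OF that(1)], folded a_def]
    show ?thesis unfolding e
    proof (rule minima_extend[where mv = "mv_row m a" and ms = "ms_row m a"], goal_cases)
      case 1 show ?case using mins that(1) rows by auto
    next
      case 2 show ?case using split that(1) rows by auto
    next
      case (3 t)
      then show ?case using that(1) rows put_min_rows[of m1 a] put_min_rows[of m2 a] a e1 e2 
        by (auto simp: hi_def)
    next
      case 4
      then show ?case using that rows put_min_rows[of m1 a] put_min_rows[of m2 a] a e1 e2 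
        by (auto simp: hi_def mid_def)
    qed
  qed
  let ?R = "\<lambda>x. same_frame m x \<and> narr x ''mid'' = narr m ''mid'' \<and> minima_of x a"
  have A: "wp set_min (\<lambda>t x. ?R x \<and> t \<le> 100) m1" if "hi - Suc 0 = Suc mid"
    using ismin_single[of "rarr m ''f''" "price m a" "D_row m a" "hi - 1"] that
    by (intro wp_set_min conjI f fin) (auto simp: e1 rows block_value_def)
  have B: "wp combine_min (\<lambda>t x. ?R x \<and> t \<le> 100) m2" if "Suc mid < hi - Suc 0"
  proof (rule wp_combine_min, goal_cases)
    case (1 t r b)
    have "ismin (rarr m ''f'') (price m a) (D_row m a) (mv_row m a (hi - 2)) (ms_row m a (hi - 2)) (Suc mid) (hi - 2)"
    proof -
      have "narr m ''lo'' a \<le> mid" "mid < hi - 2" "Suc (hi - 2) < hi"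
        using split that unfolding mid_def[symmetric] hi_def[symmetric] by auto
      then show ?thesis
        using mins unfolding partial_minima_def mid_def[symmetric] hi_def[symmetric] by blast
    qed
    then have "ismin (rarr m ''f'') (price m a) (D_row m a) r b (Suc mid) (Suc (hi - 2))"
      apply (rule ismin_extend_right)
      using 1(2) that by (simp add: e2 rows block_value_def numeral_2_eq_2 Suc_diff_Suc)
    moreover have "Suc (hi - 2) = hi - 1" using that by simp
    ultimately show ?case using f[of m2] fin[of m2] rows 1(1) by simp
  qed
  have C: "?R m1" if "\<not> mid < hi - Suc 0"
    using minima_extend[OF mins split, of "mv_row m a" "ms_row m a"] that f1 rows
    by (simp add: e1 hi_def mid_def)
  show ?thesis
    unfolding extend_minima_def wp_Seq wp_Cond wp_NAssign wp_Skip
  proof (simp add: a_def[symmetric] hi_def[symmetric] mid_def[symmetric] m1_def[symmetric] m2_def[symmetric] e1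
      , intro conjI impI, goal_cases)
    case 1
    then show ?case using A Q by (auto simp: rows mid_def elim!: wp_mono)
  next
    case 2
    then show ?case using B Q by (auto simp: rows mid_def m2_def[symmetric] elim!: wp_mono)
  next
    case 3
    then show ?case using C Q by (auto simp: rows mid_def)
  qed
qed


lemma same_frame_window: "same_frame m m' \<Longrightarrow> window m' (nvar m ''a'') j \<longleftrightarrow> window m (nvar m ''a'') j"
  using frame_price[of m m'] unfolding same_frame_def frame_def same_env_def same_window_def window_def by simp

lemma wp_repair:
  fixes m :: memory
  defines "a \<equiv> nvar m ''a''"
  assumes va: "valid_type m" and win: "window m a j" and mins: "partial_minima_of m a"
    and Q: "\<And>t m'. same_frame m m' \<Longrightarrow> minima_of m' a \<Longrightarrow>
      t + pot m' a j \<le> pot m a j + 5000 \<Longrightarrow> Q t m'"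
  shows "wp repair Q m"
proof -
  have le: "narr m ''lo'' a \<le> narr m ''hi'' a" using win unfolding window_def deque_def by simp
  have L: "narr m' ''L'' a = narr m ''L'' a" if "same_frame m m'" for m'
    using that unfolding same_frame_def same_window_def a_def by simp
  have A: "wp extend_minima (\<lambda>t m'. same_frame m m' \<and> minima_of m' a \<and> t + pot m' a j \<le> pot m a j + 300) m"
    if "narr m ''mid'' a = narr m ''lo'' a \<or>
      narr m ''lo'' a < narr m ''mid'' a \<and> Suc (narr m ''mid'' a) < narr m ''hi'' a"
    using va mins that unfolding a_def
  proof (rule wp_extend_minima, goal_cases)
    case (1 t m')
    note e = same_frameD[OF 1(1), folded a_def] and l = L[OF 1(1)]
    have "pot m' a j = pot m a j" unfolding pot_def e l 1(2) ..
    then show ?case using 1 by (simp add: a_def)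
  qed
  have B: "wp rebuild (\<lambda>t m'. same_frame m m' \<and> minima_of m' a \<and> t + pot m' a j \<le> pot m a j + 4000) m"
    if bad: "narr m ''mid'' a \<noteq> narr m ''lo'' a"
      "\<not> (narr m ''lo'' a < narr m ''mid'' a \<and> Suc (narr m ''mid'' a) < narr m ''hi'' a)"
    using va le unfolding a_def
  proof (rule wp_rebuild, goal_cases)
    case (1 t m')
    note e = same_frameD[OF 1(1), folded a_def]
    define lo hi mid mid' d where d: "lo = narr m ''lo'' a" "hi = narr m ''hi'' a" "mid = narr m ''mid'' a"
      "mid' = narr m' ''mid'' a"
      and "d = (2 * mid - (lo + hi)) + ((lo + hi) - 2 * mid)"
    define d' where "d' = (2 * mid' - (lo + hi)) + ((lo + hi) - 2 * mid')"
    define size where "size = hi - lo"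
    \<comment> \<open>An unusable split lies left of \<open>lo\<close>, or at \<open>hi - 1\<close>
      or beyond. Either way \<open>2 * mid\<close> differs from \<open>lo + hi\<close> by at least
      \<open>size - 2\<close>, so dropping the imbalance to at most 1 pays for the linear
      rebuild.\<close>
    have "size \<le> d + 2" using bad le unfolding d[symmetric] \<open>d = _\<close> size_def by arith
    moreover have "d' \<le> 1"
      using 1(3,4) unfolding a_def[symmetric] d[symmetric] d'_def by arith
    moreover have "t \<le> 400 * size + 400" using 1(5) unfolding a_def[symmetric] d[symmetric] size_def .
    ultimately have "t + 1000 * d' \<le> 1000 * d + 4000"
      by linarith
    then show ?case using 1(1,2)
      unfolding pot_def a_def[symmetric] e L[OF 1(1)] d[symmetric] \<open>d = _\<close> d'_def by simp
  qed
  show ?thesis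
    unfolding repair_def wp_Cond
    using A B Q by (auto simp: a_def[symmetric] elim!: wp_mono)
qed

section \<open>Candidates for the last group\<close>

definition maxcost :: "(nat \<Rightarrow> real) \<Rightarrow> nat \<Rightarrow> nat \<Rightarrow> real" where
  "maxcost s st j = Max (s ` {Suc st..j})"

text \<open>\<open>(b, st, v)\<close> stands for a last group of type \<open>b\<close> that starts after job \<open>st\<close>, giving total cost \<open>v\<close>.
  The type \<open>0\<close> means that no group has been found.\<close>

definition best_of :: "(nat \<times> nat \<times> real) set \<Rightarrow> memory \<Rightarrow> bool" where
  "best_of C m \<longleftrightarrow>
     (nvar m ''bt'' \<noteq> 0 \<longrightarrow> (nvar m ''bt'', nvar m ''bs'', rvar m ''bv'') \<in> C) \<and>
     (\<forall>(b, st, v) \<in> C. nvar m ''bt'' \<noteq> 0 \<and> rvar m ''bv'' \<le> v)"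

text \<open>Lets the few triples actually offered stand for all candidates of a type.\<close>

lemma best_of_dominate:
  assumes "best_of (C \<union> X) m" "X \<subseteq> Y" "\<forall>(b, st, v)\<in>Y. \<exists>(b', st', v')\<in>X. v' \<le> v"
  shows "best_of (C \<union> Y) m"
proof -
  have "nvar m ''bt'' \<noteq> 0 \<and> rvar m ''bv'' \<le> v" if in_Y: "(b, st, v) \<in> Y" for b st v
  proof -
    obtain b' st' v' where "(b', st', v') \<in> X" "v' \<le> v" using bspec[OF assms(3) in_Y] by auto
    then show ?thesis
      using assms(1) unfolding best_of_def by (auto dest!: bspec[of _ _ "(b', st', v')"])
  qed
  moreover have "nvar m ''bt'' \<noteq> 0 \<and> rvar m ''bv'' \<le> v" if "(b, st, v) \<in> C" for b st v
    using assms(1) that unfolding best_of_def by fastforce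
  ultimately show ?thesis using assms(1,2) unfolding best_of_def by auto
qed

definition only_best :: "memory \<Rightarrow> memory \<Rightarrow> bool" where
  "only_best m m' \<longleftrightarrow> narr m' = narr m \<and> rarr m' = rarr m \<and>
     (\<forall>z. z \<noteq> ''bt'' \<and> z \<noteq> ''bs'' \<longrightarrow> nvar m' z = nvar m z)"

lemma only_best_rows:
  assumes "only_best m m'"
  shows "D_row m' = D_row m" "mv_row m' = mv_row m" "ms_row m' = ms_row m" "price m' = price m"
    "block_value m' = block_value m" "frame m m'" "window m' a j = window m a j" "pot m' a j = pot m a j"
    "nvar m' ''a'' = nvar m ''a''" "nvar m' ''k'' = nvar m ''k''" "narr m' = narr m" "rarr m' = rarr m"
proof -
  have e: "narr m' = narr m" "rarr m' = rarr m" "nvar m' ''k'' = nvar m ''k''" "nvar m' ''a'' = nvar m ''a''"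
    "nvar m' ''n'' = nvar m ''n''" "nvar m' ''j'' = nvar m ''j''" "nvar m' ''feasible'' = nvar m ''feasible''"
    using assms by (auto simp: only_best_def)
  show rows: "D_row m' = D_row m" "mv_row m' = mv_row m" "ms_row m' = ms_row m" "price m' = price m"
    by (auto simp: e D_row_def mv_row_def ms_row_def price_def fun_eq_iff)
  show "block_value m' = block_value m" by (auto simp: e rows block_value_def fun_eq_iff)
  show "frame m m'" by (auto simp: frame_def same_defs e rows)
  show "window m' a j = window m a j" "pot m' a j = pot m a j" by (simp_all add: window_def pot_def e rows)
qed (use assms in \<open>auto simp: only_best_def\<close>)

definition offer :: "rexp \<Rightarrow> nexp \<Rightarrow> com" where
  "offer v st =
     Cond (Conj (Neg (NEq (NVar ''bt'') (NLit 0))) (Neg (RLess v (RVar ''bv'')))) Skip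
       (Seq (RAssign ''bv'' v) (Seq (NAssign ''bs'' st) (NAssign ''bt'' (NVar ''a''))))"

text \<open>\<open>bv\<close> is written before \<open>st\<close> is evaluated, hence the assumption
  that \<open>st\<close> does not depend on real variables. The factor 2 arises because
  \<open>v\<close> is evaluated once for the comparison and once for the assignment.\<close>

lemma wp_offer:
  assumes "best_of C m" "valid_type m"
    and st: "\<And>x. nval (m\<lparr>rvar := x\<rparr>) st = nval m st"
    and Q: "\<And>t m'. only_best m m' \<Longrightarrow> best_of (insert (nvar m ''a'', nval m st, rval m v) C) m' \<Longrightarrow>
      t \<le> 2 * rtime v + ntime st + 30 \<Longrightarrow> Q t m'"
  shows "wp (offer v st) Q m"
  unfolding offer_def wp_simps
proof (intro conjI impI, goal_cases)
  case 1
  show ?case using assms(1) 1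
    by (intro Q) (auto simp: only_best_def best_of_def)
next
  case 2
  show ?case using assms(1,2) 2 st
    by (intro Q) (fastforce simp: only_best_def best_of_def)+
qed

definition query :: com where
  "query =
     Cond (NLess Lo Hi)
       (Seq (offer (Block_value Lo) (D_at Lo))
       (Seq (Cond (NLess Lo Mid)
              (offer (RArr ''mv'' (Cell (NAdd Lo (NLit 1)))) (NArr ''ms'' (Cell (NAdd Lo (NLit 1))))) Skip)
            (Cond (NLess (NAdd Mid (NLit 1)) Hi)
              (offer (RArr ''mv'' (Cell (NSub Hi (NLit 1)))) (NArr ''ms'' (Cell (NSub Hi (NLit 1))))) Skip)))
       Skip"

text \<open>\<open>X\<close> collects the at most three offers: block \<open>lo\<close>, the minimum
  of the front and the minimum of the back. Callers learn only that each offer stems from a block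
  and that each block is matched by an offer at most as expensive.\<close>

lemma wp_query:
  fixes m :: memory
  defines "a \<equiv> nvar m ''a''"
  assumes va: "valid_type m" and best: "best_of C m" and mins: "minima_of m a"
    and Q: "\<And>t m' X. only_best m m' \<Longrightarrow> best_of (C \<union> X) m' \<Longrightarrow>
      X \<subseteq> (\<lambda>t. (a, D_row m a t, block_value m a t)) ` {narr m ''lo'' a..<narr m ''hi'' a} \<Longrightarrow>
      \<forall>t\<in>{narr m ''lo'' a..<narr m ''hi'' a}. \<exists>(b, st, v)\<in>X. v \<le> block_value m a t \<Longrightarrow>
      t \<le> 500 \<Longrightarrow> Q t m'"
  shows "wp query Q m"
proof -
  define lo hi mid where "lo = narr m ''lo'' a" and "hi = narr m ''hi'' a" and "mid = narr m ''mid'' a"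
  note ld = lo_def[symmetric] hi_def[symmetric] mid_def[symmetric] a_def[symmetric]
  define B where "B = (\<lambda>t. (a, D_row m a t, block_value m a t)) ` {lo..<hi}"
  define X1 where "X1 = {(a, D_row m a lo, block_value m a lo)}"
  define X2 where "X2 = (if lo < mid then {(a, ms_row m a (Suc lo), mv_row m a (Suc lo))} else {})"
  define X3 where "X3 = (if Suc mid < hi then {(a, ms_row m a (hi - 1), mv_row m a (hi - 1))} else {})"
  have split: "mid = lo \<or> lo < mid \<and> mid < hi" using mins unfolding minima_def ld by blast
  have min2: "ismin (rarr m ''f'') (price m a) (D_row m a) (mv_row m a (Suc lo)) (ms_row m a (Suc lo)) (Suc lo) mid"
    if "lo < mid" using mins that unfolding minima_def ld by auto
  have min3: "ismin (rarr m ''f'') (price m a) (D_row m a) (mv_row m a (hi - 1)) (ms_row m a (hi - 1)) (Suc mid) (hi - 1)"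
    if "Suc mid < hi" using mins that unfolding minima_def ld by auto
  show ?thesis
  proof (cases "lo < hi")
    case False
    show ?thesis unfolding query_def wp_Cond wp_Skip
      using False Q[of m "{}"] best by (auto simp: ld only_best_def)
  next
    case True
    have sub: "X1 \<union> X2 \<union> X3 \<subseteq> B"
    proof -
      have "X1 \<subseteq> B" using True unfolding X1_def B_def by auto
      moreover have "X2 \<subseteq> B"
      proof (cases "lo < mid")
        case T: True
        then obtain x where "x \<in> {Suc lo..mid}" "ms_row m a (Suc lo) = D_row m a x"
          "mv_row m a (Suc lo) = block_value m a x"
          using min2 unfolding ismin_def block_value_def by blast
        then show ?thesis using T split unfolding X2_def B_def by auto
      qed (simp add: X2_def)
      moreover have "X3 \<subseteq> B"
      proof (cases "Suc mid < hi")
        case T: True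
        then obtain x where "x \<in> {Suc mid..hi - 1}" "ms_row m a (hi - 1) = D_row m a x"
          "mv_row m a (hi - 1) = block_value m a x"
          using min3 unfolding ismin_def block_value_def by blast
        then show ?thesis using T split unfolding X3_def B_def by auto
      qed (simp add: X3_def)
      ultimately show ?thesis by blast
    qed
    have cov: "\<forall>t\<in>{lo..<hi}. \<exists>(b, st, v)\<in>X1 \<union> X2 \<union> X3. v \<le> block_value m a t"
    proof
      fix t assume t: "t \<in> {lo..<hi}"
      then consider "t = lo" | "lo < t" "t \<le> mid" | "mid < t" "lo < t" by fastforce
      then show "\<exists>(b, st, v)\<in>X1 \<union> X2 \<union> X3. v \<le> block_value m a t"
      proof cases
        case 1 then show ?thesis unfolding X1_def by auto
      next
        case 2 then show ?thesis using min2 unfolding X2_def ismin_def block_value_def by auto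
      next
        case 3 then show ?thesis using min3 t unfolding X3_def ismin_def block_value_def by auto
      qed
    qed
    have c: "wp (offer v st) (\<lambda>t x. only_best m x \<and> best_of (C' \<union> {(a, nval m1 st, rval m1 v)}) x \<and>
         t \<le> 2 * rtime v + ntime st + 30) m1"
      if "only_best m m1" "best_of C' m1" "\<And>x. nval (m1\<lparr>rvar := x\<rparr>) st = nval m1 st" for m1 C' v st
    proof (rule wp_offer[OF that(2) _ that(3)], goal_cases)
      case 1
      show ?case using va only_best_rows(9,10)[OF that(1)] by simp
    next
      case (2 t m')
      have "only_best m m'" using that(1) 2(1) unfolding only_best_def by metis
      then show ?case using 2 only_best_rows(9)[OF that(1)] by (simp add: a_def)
    qed
    have c1: "wp (offer (Block_value Lo) (D_at Lo))
      (\<lambda>t x. only_best m x \<and> best_of (C \<union> X1) x \<and> t \<le> 100) m"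
    proof -
      have "only_best m m" by (simp add: only_best_def)
      from c[OF this best, of "D_at Lo" "Block_value Lo"] show ?thesis
        by (rule wp_mono) (auto simp: X1_def block_value_def D_row_def price_def ld)
    qed
    have c2: "wp (Cond (NLess Lo Mid)
              (offer (RArr ''mv'' (Cell (NAdd Lo (NLit 1)))) (NArr ''ms'' (Cell (NAdd Lo (NLit 1))))) Skip)
      (\<lambda>t x. only_best m x \<and> best_of (C \<union> X1 \<union> X2) x \<and> t \<le> 100) m1"
      if "only_best m m1" "best_of (C \<union> X1) m1" for m1
    proof -
      note e = only_best_rows[OF that(1)]
      from c[OF that, of "NArr ''ms'' (Cell (NAdd Lo (NLit 1)))" "RArr ''mv'' (Cell (NAdd Lo (NLit 1)))"] show ?thesis
        unfolding wp_Cond wp_Skip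
        using that by (intro conjI impI) (auto simp: e X2_def mv_row_def ms_row_def ld elim: wp_mono)
    qed
    have c3: "wp (Cond (NLess (NAdd Mid (NLit 1)) Hi)
              (offer (RArr ''mv'' (Cell (NSub Hi (NLit 1)))) (NArr ''ms'' (Cell (NSub Hi (NLit 1))))) Skip)
      (\<lambda>t x. only_best m x \<and> best_of (C \<union> X1 \<union> X2 \<union> X3) x \<and> t \<le> 100) m1"
      if "only_best m m1" "best_of (C \<union> X1 \<union> X2) m1" for m1
    proof -
      note e = only_best_rows[OF that(1)]
      from c[OF that, of "NArr ''ms'' (Cell (NSub Hi (NLit 1)))" "RArr ''mv'' (Cell (NSub Hi (NLit 1)))"] show ?thesis
        unfolding wp_Cond wp_Skip
        using that by (intro conjI impI) (auto simp: e X3_def mv_row_def ms_row_def ld elim: wp_mono)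
    qed
    have "wp query (\<lambda>t x. only_best m x \<and> best_of (C \<union> (X1 \<union> X2 \<union> X3)) x \<and> t \<le> 500) m"
      unfolding query_def wp_Cond[of "NLess Lo Hi"] wp_Seq
    proof (intro conjI impI, goal_cases)
      case 1
      show ?case
        apply (rule wp_mono[OF c1], elim conjE)
        apply (rule wp_mono[OF c2], assumption, assumption, elim conjE)
        apply (rule wp_mono[OF c3], assumption, assumption)
        apply (simp add: Un_assoc)
        done
    next
      case 2
      then show ?case using True by (simp add: ld)
    qed
    then show ?thesis
      by (rule wp_mono) (use Q sub cov in \<open>auto simp: ld B_def\<close>)
  qed
qed

definition candidates :: "memory \<Rightarrow> nat \<Rightarrow> nat \<Rightarrow> (nat \<times> nat \<times> real) set" where
  "candidates m a j = {(a, st, rarr m ''f'' st + maxcost (price m a) st j) | st.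
     st < j \<and> wsum (rarr m ''weight'') st j \<le> rarr m ''threshold'' a}"

lemma wsum_antimono:
  assumes "\<And>i. 0 \<le> w i" "l \<le> l'"
  shows "wsum w l' j \<le> wsum w l j"
  unfolding wsum_def by (rule sum_mono2) (use assms in auto)

text \<open>Passes from blocks to all admissible starts. A start \<open>st\<close> in block
  \<open>t\<close> can be replaced by \<open>D t\<close>: this does not raise \<open>f\<close>, and
  a group starting after \<open>st\<close> already contains the job \<open>D (Suc t)\<close> that
  determines the maximum. Monotonicity of \<open>f\<close> is available only below \<open>j\<close>,
  since \<open>f j\<close> is still being computed.\<close>

lemma candidates_cover:
  fixes m :: memory
  assumes win: "window m a j" and S: "rarr m ''S'' a \<le> rarr m ''threshold'' a"
    and w: "\<And>i. 0 \<le> rarr m ''weight'' i"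
    and mono: "\<And>i i'. i \<le> i' \<Longrightarrow> i' < j \<Longrightarrow> rarr m ''f'' i \<le> rarr m ''f'' i'"
    and best: "best_of (C \<union> X) x"
    and X: "X \<subseteq> (\<lambda>t. (a, D_row m a t, block_value m a t)) ` {narr m ''lo'' a..<narr m ''hi'' a}"
    and cov: "\<forall>t\<in>{narr m ''lo'' a..<narr m ''hi'' a}. \<exists>(b, st, v)\<in>X. v \<le> block_value m a t"
  shows "best_of (C \<union> candidates m a j) x"
  using best
proof (rule best_of_dominate)
  define lo hi L D s where d: "lo = narr m ''lo'' a" "hi = narr m ''hi'' a" "L = narr m ''L'' a"
    "D = D_row m a" "s = price m a"
  have dq: "deque s D lo hi" "D lo = L" "D hi = j" using win unfolding window_def d by auto
  have less: "D t < j" "D (Suc t) \<le> j" "L \<le> D t" "D t < D (Suc t)" if "lo \<le> t" "t < hi" for t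
    using deque_less[OF dq(1), of t hi] deque_less[OF dq(1), of lo t] deque_less[OF dq(1), of "Suc t" hi]
      deque_less[OF dq(1), of t "Suc t"] that dq(2,3)
    by (cases "Suc t = hi"; cases "lo = t"; simp)+
  have max: "maxcost s (D t) j = s (D (Suc t))" if "lo \<le> t" "t < hi" for t
    unfolding maxcost_def
    using deque_max[OF dq(1) that] less[OF that] dq(3) by (intro Max_eqI) auto
  show "X \<subseteq> candidates m a j"
  proof
    fix y assume "y \<in> X"
    then have "y \<in> (\<lambda>t. (a, D t, block_value m a t)) ` {lo..<hi}" using X unfolding d by blast
    then obtain t where t: "lo \<le> t" "t < hi" "y = (a, D t, block_value m a t)" by auto
    have "wsum (rarr m ''weight'') (D t) j \<le> rarr m ''threshold'' a"
      using wsum_antimono[of "rarr m ''weight''" L "D t" j] w less[OF t(1,2)] S win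
      unfolding window_def d(3)[symmetric] by simp
    then show "y \<in> candidates m a j"
      using t less[OF t(1,2)] max[OF t(1,2)] unfolding candidates_def block_value_def by (auto simp: d)
  qed
  have "\<exists>(b', st', v')\<in>X. v' \<le> rarr m ''f'' st + maxcost s st j"
    if st: "st < j" "wsum (rarr m ''weight'') st j \<le> rarr m ''threshold'' a" for st
  proof -
    have "L \<le> st" using st(2) win unfolding window_def d(3)[symmetric] by (meson leD leI)
    then obtain t where t: "lo \<le> t" "t < hi" "D t \<le> st" "st < D (Suc t)"
      using deque_block[OF dq(1), of st] dq(2,3) st(1) by blast
    have "s (D (Suc t)) \<le> maxcost s st j"
      unfolding maxcost_def using t less[OF t(1,2)] by (intro Max_ge) auto
    then have "block_value m a t \<le> rarr m ''f'' st + maxcost s st j"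
      using mono[OF t(3) st(1)] unfolding block_value_def by (simp add: d)
    moreover obtain b' st' v' where "(b', st', v') \<in> X" "v' \<le> block_value m a t"
      using cov t(1,2) d by fastforce
    ultimately show ?thesis by (intro bexI[of _ "(b', st', v')"]) auto
  qed
  then show "\<forall>(b, st, v)\<in>candidates m a j. \<exists>(b', st', v')\<in>X. v' \<le> v"
    unfolding candidates_def by (auto simp: d)
qed

section \<open>One job for one type and for all types\<close>

definition process_type :: com where
  "process_type = Seq push_job (Seq shrink_window (Seq repair query))"

definition deque_inv :: "memory \<Rightarrow> nat \<Rightarrow> nat \<Rightarrow> bool" where
  "deque_inv m a j \<longleftrightarrow> window m a j \<and> minima_of m a"

lemma best_of_same: "same_best m m' \<Longrightarrow> best_of C m' \<longleftrightarrow> best_of C m"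
  unfolding best_of_def same_best_def by simp

lemma candidates_frame: "frame m m' \<Longrightarrow> candidates m' a j = candidates m a j"
  using frame_price[of m m'] unfolding candidates_def frame_def same_env_def by simp

lemma wp_process_type:
  fixes m :: memory
  defines "a \<equiv> nvar m ''a''" and "j \<equiv> nvar m ''j''"
  assumes va: "valid_type m" and j: "0 < j" and w: "\<And>i. 0 \<le> rarr m ''weight'' i"
    and th: "0 \<le> rarr m ''threshold'' a"
    and inv: "deque_inv m a (j - 1)" and best: "best_of C m"
    and mono: "\<And>i i'. i \<le> i' \<Longrightarrow> i' < j \<Longrightarrow> rarr m ''f'' i \<le> rarr m ''f'' i'"
    and Q: "\<And>t m'. frame m m' \<Longrightarrow> deque_inv m' a j \<Longrightarrow> best_of (C \<union> candidates m a j) m' \<Longrightarrow>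
      t + pot m' a j \<le> pot m a (j - 1) + 30000 \<Longrightarrow> Q t m'"
  shows "wp process_type Q m"
  unfolding process_type_def wp_Seq
proof (rule wp_push_job, goal_cases)
  case 1 show ?case using va .
next
  case 2 show ?case using j j_def by simp
next
  case 3 show ?case using w .
next
  case 4 show ?case using inv a_def j_def unfolding deque_inv_def by simp
next
  case 5 show ?case using inv a_def unfolding deque_inv_def by simp
next
  case (6 t1 m1)
  note p1 = 6[folded a_def j_def]
  note a1 = frame_a[OF p1(1), folded a_def]
  show ?case
  proof (rule wp_shrink_window[where j = j], goal_cases)
    case 1 show ?case using va a1 a_def by simp
  next
    case 2 show ?case using th a1 p1(1) unfolding frame_def same_env_def by simp
  next
    case 3 show ?case using p1(3) a1 by simp
  next
    case 4 show ?case using p1(4) a1 by simp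
  next
    case (5 t2 m2)
    then have p2: "frame m m2" "same_best m m2" "window m2 a j" "partial_minima_of m2 a"
      "rarr m2 ''S'' a \<le> rarr m2 ''threshold'' a" "t2 + pot m2 a j \<le> pot m1 a j + 100"
      using frame_trans[OF p1(1)] same_best_trans[OF p1(2)] a1 by auto
    note a2 = frame_a[OF p2(1), folded a_def]
    show ?case
    proof (rule wp_repair[where j = j], goal_cases)
      case 1 show ?case using va a2 a_def by simp
    next
      case 2 show ?case using p2(3) a2 by simp
    next
      case 3 show ?case using p2(4) a2 by simp
    next
      case (4 t3 m3)
      have p3: "frame m m3" "same_best m m3" "window m3 a j" "minima_of m3 a"
        "rarr m3 ''S'' a \<le> rarr m3 ''threshold'' a" "t3 + pot m3 a j \<le> pot m2 a j + 5000"
        using 4 p2 frame_trans[OF p2(1)] same_best_trans[OF p2(2)] a2 same_frame_window[OF 4(1)]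
        unfolding same_frame_def by (auto simp: same_window_def frame_def same_env_def)
      note a3 = frame_a[OF p3(1), folded a_def]
      have env3: "rarr m3 ''weight'' = rarr m ''weight''" "rarr m3 ''f'' = rarr m ''f''"
        using p3(1) unfolding frame_def same_env_def by auto
      show ?case
      proof (rule wp_query[where C = C], goal_cases)
        case 1 show ?case using va a3 a_def by simp
      next
        case 2 show ?case using best best_of_same[OF p3(2)] by simp
      next
        case 3 show ?case using p3(4) a3 by simp
      next
        case (4 t4 m4 X)
        note p4 = 4[unfolded a3[THEN conjunct1]]
        note r = only_best_rows[OF p4(1)]
        have "best_of (C \<union> candidates m3 a j) m4"
          by (rule candidates_cover[OF p3(3,5) _ _ p4(2-4)]) (use w mono env3 in auto)
        then have "best_of (C \<union> candidates m a j) m4" using candidates_frame[OF p3(1)] by simp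
        moreover have "deque_inv m4 a j" unfolding deque_inv_def using p3(3,4) r by simp
        moreover have "frame m m4" by (rule frame_trans[OF p3(1) r(6)])
        moreover have "pot m4 a j = pot m3 a j" using r(8) .
        ultimately show ?case using p1(5) p2(6) p3(6) p4(5) by (intro Q) auto
      qed
    qed
  qed
qed

text \<open>Unlike \<open>same_env\<close> this lets the type counter \<open>a\<close> change, so
  that it can be carried through the loop over the types.\<close>

definition same_dp :: "memory \<Rightarrow> memory \<Rightarrow> bool" where
  "same_dp m m' \<longleftrightarrow>
     nvar m' ''n'' = nvar m ''n'' \<and> nvar m' ''k'' = nvar m ''k'' \<and>
     nvar m' ''j'' = nvar m ''j'' \<and> nvar m' ''feasible'' = nvar m ''feasible'' \<and>
     rarr m' ''weight'' = rarr m ''weight'' \<and> rarr m' ''cost'' = rarr m ''cost'' \<and>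
     rarr m' ''threshold'' = rarr m ''threshold'' \<and> rarr m' ''f'' = rarr m ''f'' \<and>
     narr m' ''cnt'' = narr m ''cnt'' \<and> narr m' ''pred'' = narr m ''pred'' \<and>
     narr m' ''typ'' = narr m ''typ'' \<and> narr m' ''end'' = narr m ''end''"

lemma same_dp_candidates: "same_dp m m' \<Longrightarrow> candidates m' a j = candidates m a j"
  unfolding candidates_def same_dp_def price_def by simp

lemma frame_same_dp: "same_dp m m1 \<Longrightarrow> frame m1 m' \<Longrightarrow> same_dp m m'"
  unfolding same_dp_def frame_def same_env_def by simp

lemma frame_other:
  assumes "frame m m'" "b \<in> {1..nvar m ''k''}" "b \<noteq> nvar m ''a''"
  shows "deque_inv m' b j \<longleftrightarrow> deque_inv m b j" "pot m' b j = pot m b j"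
proof -
  have "same_window b m m'" "same_minima b m m'" "same_env m m'" using assms unfolding frame_def by auto
  then show "deque_inv m' b j \<longleftrightarrow> deque_inv m b j" "pot m' b j = pot m b j"
    using frame_price[OF assms(1)]
    unfolding deque_inv_def window_def pot_def same_defs by auto
qed

definition process_types :: com where
  "process_types =
     While (NLess (NVar ''a'') (NVar ''k'')) (Seq (NAssign ''a'' (NAdd (NVar ''a'') (NLit 1))) process_type)"

lemma a_upd:
  "deque_inv (m\<lparr>nvar := (nvar m)(''a'' := v)\<rparr>) b j \<longleftrightarrow> deque_inv m b j"
  "pot (m\<lparr>nvar := (nvar m)(''a'' := v)\<rparr>) b j = pot m b j"
  "best_of C (m\<lparr>nvar := (nvar m)(''a'' := v)\<rparr>) \<longleftrightarrow> best_of C m"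
  "same_dp m' (m\<lparr>nvar := (nvar m)(''a'' := v)\<rparr>) \<longleftrightarrow> same_dp m' m"
  unfolding deque_inv_def window_def pot_def best_of_def same_dp_def by simp_all

text \<open>In the middle of the loop the types up to \<open>a\<close> have absorbed job
  \<open>j\<close>, while the windows of the others still end at \<open>j - 1\<close>; invariant and
  measure take each type at its own position.\<close>

lemma wp_process_types:
  fixes m :: memory
  defines "k \<equiv> nvar m ''k''" and "j \<equiv> nvar m ''j''"
  assumes a0: "nvar m ''a'' = 0" and j: "0 < j" and w: "\<And>i. 0 \<le> rarr m ''weight'' i"
    and th: "\<And>a. 0 \<le> rarr m ''threshold'' a"
    and inv: "\<forall>b\<in>{1..k}. deque_inv m b (j - 1)" and best: "best_of {} m"
    and mono: "\<And>i i'. i \<le> i' \<Longrightarrow> i' < j \<Longrightarrow> rarr m ''f'' i \<le> rarr m ''f'' i'"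
    and Q: "\<And>t m'. same_dp m m' \<Longrightarrow> \<forall>b\<in>{1..k}. deque_inv m' b j \<Longrightarrow>
      best_of (\<Union>b\<in>{1..k}. candidates m b j) m' \<Longrightarrow>
      t + (\<Sum>b\<in>{1..k}. pot m' b j) \<le> (\<Sum>b\<in>{1..k}. pot m b (j - 1)) + 40000 * k + 100 \<Longrightarrow> Q t m'"
  shows "wp process_types Q m"
  unfolding process_types_def
proof (rule wp_While[where Inv = "\<lambda>m'. same_dp m m' \<and> nvar m' ''a'' \<le> k \<and>
      (\<forall>b\<in>{1..k}. deque_inv m' b (if b \<le> nvar m' ''a'' then j else j - 1)) \<and>
      best_of (\<Union>b\<in>{1..nvar m' ''a''}. candidates m b j) m'" and
      \<Phi> = "\<lambda>m'. 40000 * (k - nvar m' ''a'') +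
        (\<Sum>b\<in>{1..k}. pot m' b (if b \<le> nvar m' ''a'' then j else j - 1))"], goal_cases)
  case 1
  show ?case using a0 inv best by (simp add: same_dp_def)
next
  case (3 t m')
  then have "nvar m' ''a'' = k" by (simp add: same_dp_def k_def)
  with 3 show ?case by (intro Q) (auto simp: a0)
next
  case (2 m')
  define a where "a = Suc (nvar m' ''a'')"
  define m1 where "m1 = m'\<lparr>nvar := (nvar m')(''a'' := a)\<rparr>"
  have m1: "nvar m1 ''a'' = a" "same_dp m m1" "\<And>C. best_of C m1 = best_of C m'"
    "\<And>b i. deque_inv m1 b i = deque_inv m' b i" "\<And>b i. pot m1 b i = pot m' b i"
    using 2 by (simp_all add: m1_def a_upd)
  have env: "nvar m1 ''k'' = k" "nvar m1 ''j'' = j" "rarr m1 ''weight'' = rarr m ''weight''"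
    "rarr m1 ''threshold'' = rarr m ''threshold''" "rarr m1 ''f'' = rarr m ''f''"
    using m1(2) unfolding same_dp_def k_def j_def by auto
  have a: "a \<in> {1..k}" using 2 env by (simp add: a_def m1_def)
  let ?C = "\<Union>b\<in>{1..nvar m' ''a''}. candidates m b j"
  have inv_a: "deque_inv m' a (j - 1)"
    using 2(1) bspec[OF _ a, of "\<lambda>b. deque_inv m' b (if b \<le> nvar m' ''a'' then j else j - 1)"]
    by (simp add: a_def)
  have "wp process_type (\<lambda>t x. frame m1 x \<and> deque_inv x a j \<and> best_of (?C \<union> candidates m a j) x \<and>
      t + pot x a j \<le> pot m1 a (j - 1) + 30000) m1"
    by (rule wp_process_type[where C = ?C])
      (use a env m1 2 w th mono j inv_a same_dp_candidates[OF m1(2)] in auto)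
  moreover have "same_dp m x \<and> nvar x ''a'' = a \<and>
      (\<forall>b\<in>{1..k}. deque_inv x b (if b \<le> a then j else j - 1)) \<and>
      best_of (\<Union>b\<in>{1..a}. candidates m b j) x \<and>
      t + 40000 * (k - a) + 10000 + (\<Sum>b\<in>{1..k}. pot x b (if b \<le> a then j else j - 1)) \<le>
        40000 * (k - nvar m' ''a'') + (\<Sum>b\<in>{1..k}. pot m' b (if b \<le> nvar m' ''a'' then j else j - 1))"
    if x: "frame m1 x" "deque_inv x a j" "best_of (?C \<union> candidates m a j) x"
      "t + pot x a j \<le> pot m1 a (j - 1) + 30000" for t x
  proof (intro conjI)
    show "same_dp m x" using frame_same_dp[OF m1(2) x(1)] .
    show "nvar x ''a'' = a" using frame_a[OF x(1)] m1 by simp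
    show "\<forall>b\<in>{1..k}. deque_inv x b (if b \<le> a then j else j - 1)"
    proof
      fix b assume b: "b \<in> {1..k}"
      have "b \<le> a \<longleftrightarrow> b \<le> nvar m' ''a''" if "b \<noteq> a" using that a_def by auto
      then show "deque_inv x b (if b \<le> a then j else j - 1)"
        using x(2) 2 frame_other(1)[OF x(1), of b] b env m1 by (cases "b = a") auto
    qed
    have "{1..a} = insert a {1..nvar m' ''a''}" unfolding a_def by auto
    then show "best_of (\<Union>b\<in>{1..a}. candidates m b j) x" using x(3) by (simp add: Un_commute)
    let ?new = "\<lambda>b. pot x b (if b \<le> a then j else j - 1)"
    let ?old = "\<lambda>b. pot m' b (if b \<le> nvar m' ''a'' then j else j - 1)"
    \<comment> \<open>By the frame property only the summand of the current type changes.\<close>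
    have "sum ?new ({1..k} - {a}) = sum ?old ({1..k} - {a})"
    proof (rule sum.cong[OF refl])
      fix b assume b: "b \<in> {1..k} - {a}"
      then have "b \<le> a \<longleftrightarrow> b \<le> nvar m' ''a''" using a_def by auto
      then show "?new b = ?old b" using frame_other(2)[OF x(1), of b] b env m1 by simp
    qed
    then have "sum ?new {1..k} = pot x a j + sum ?old ({1..k} - {a})"
      "sum ?old {1..k} = pot m' a (j - 1) + sum ?old ({1..k} - {a})"
      using sum.remove[of "{1..k}" a ?new] sum.remove[of "{1..k}" a ?old] a by (simp_all add: a_def)
    then show "t + 40000 * (k - a) + 10000 + sum ?new {1..k} \<le> 40000 * (k - nvar m' ''a'') + sum ?old {1..k}"
      using x(4) m1(5) a by (simp add: a_def)
  qed
  ultimately have "wp process_type (\<lambda>t x. same_dp m x \<and> nvar x ''a'' = a \<and>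
      (\<forall>b\<in>{1..k}. deque_inv x b (if b \<le> a then j else j - 1)) \<and>
      best_of (\<Union>b\<in>{1..a}. candidates m b j) x \<and>
      t + 40000 * (k - a) + 10000 + (\<Sum>b\<in>{1..k}. pot x b (if b \<le> a then j else j - 1)) \<le>
        40000 * (k - nvar m' ''a'') + (\<Sum>b\<in>{1..k}. pot m' b (if b \<le> nvar m' ''a'' then j else j - 1))) m1"
    by (elim wp_mono) blast
  then show ?case
    unfolding wp_Seq wp_NAssign
    apply (simp add: a_def[symmetric] m1_def[symmetric])
    apply (erule wp_mono)
    using a apply auto
    done
qed

section \<open>The dynamic program\<close>

lemma maxcost_extend: "st < j \<Longrightarrow> maxcost s st j \<le> maxcost s st (Suc j)"
  unfolding maxcost_def by (rule Max_mono) auto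

lemma maxcost_nonneg:
  assumes "\<And>i. 0 \<le> s i" "st < j"
  shows "0 \<le> maxcost s st j"
  using assms unfolding maxcost_def by (intro order_trans[OF assms(1)[of j] Max_ge]) auto

text \<open>The optimality equation for prefix \<open>i\<close> together with the choices that
  attain it. \<open>cnt\<close> counts the groups, so that backtracking knows the final position of
  each group.\<close>

definition dp_cell :: "memory \<Rightarrow> nat \<Rightarrow> bool" where
  "dp_cell m i \<longleftrightarrow>
     (let f = rarr m ''f''; w = rarr m ''weight''; th = rarr m ''threshold'';
          a = narr m ''typ'' i; p = narr m ''pred'' i
      in a \<in> {1..nvar m ''k''} \<and> p < i \<and> wsum w p i \<le> th a \<and> f i = f p + maxcost (price m a) p i \<and>
         narr m ''cnt'' i = Suc (narr m ''cnt'' p) \<and>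
         (\<forall>b\<in>{1..nvar m ''k''}. \<forall>st<i. wsum w st i \<le> th b \<longrightarrow> f i \<le> f st + maxcost (price m b) st i))"

definition dp :: "memory \<Rightarrow> nat \<Rightarrow> bool" where
  "dp m j \<longleftrightarrow> rarr m ''f'' 0 = 0 \<and> narr m ''cnt'' 0 = 0 \<and> (\<forall>i\<in>{1..j}. dp_cell m i)"

lemma dp_cellD:
  assumes "dp m j" "0 < i" "i \<le> j"
  shows "narr m ''typ'' i \<in> {1..nvar m ''k''}" "narr m ''pred'' i < i"
    "wsum (rarr m ''weight'') (narr m ''pred'' i) i \<le> rarr m ''threshold'' (narr m ''typ'' i)"
    "rarr m ''f'' i = rarr m ''f'' (narr m ''pred'' i) +
       maxcost (price m (narr m ''typ'' i)) (narr m ''pred'' i) i"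
    "narr m ''cnt'' i = Suc (narr m ''cnt'' (narr m ''pred'' i))"
    "\<And>b st. b \<in> {1..nvar m ''k''} \<Longrightarrow> st < i \<Longrightarrow> wsum (rarr m ''weight'') st i \<le> rarr m ''threshold'' b \<Longrightarrow>
       rarr m ''f'' i \<le> rarr m ''f'' st + maxcost (price m b) st i"
proof -
  have "dp_cell m i" using assms unfolding dp_def by auto
  note cell = this[unfolded dp_cell_def Let_def]
  show "narr m ''typ'' i \<in> {1..nvar m ''k''}" "narr m ''pred'' i < i"
    "wsum (rarr m ''weight'') (narr m ''pred'' i) i \<le> rarr m ''threshold'' (narr m ''typ'' i)"
    "rarr m ''f'' i = rarr m ''f'' (narr m ''pred'' i) +
       maxcost (price m (narr m ''typ'' i)) (narr m ''pred'' i) i"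
    "narr m ''cnt'' i = Suc (narr m ''cnt'' (narr m ''pred'' i))"
    using cell by blast+
  show "rarr m ''f'' i \<le> rarr m ''f'' st + maxcost (price m b) st i"
    if "b \<in> {1..nvar m ''k''}" "st < i" "wsum (rarr m ''weight'') st i \<le> rarr m ''threshold'' b" for b st
    using cell that by blast
qed

text \<open>Dropping the last job from an optimal solution does not increase its cost.\<close>

lemma dp_mono:
  assumes dp: "dp m j" and w: "\<And>i. 0 \<le> rarr m ''weight'' i" and c: "\<And>p. 0 \<le> rarr m ''cost'' p"
    and le: "i \<le> i'" "i' \<le> j"
  shows "rarr m ''f'' i \<le> rarr m ''f'' i'"
  using le
proof (induction i' rule: dec_induct)
  case (step i')
  define p a where "p = narr m ''pred'' (Suc i')" and "a = narr m ''typ'' (Suc i')"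
  have price: "0 \<le> price m b x" for b x unfolding price_def using c .
  note D = dp_cellD[OF dp, of "Suc i'", simplified, OF step.prems, folded p_def a_def]
  have "rarr m ''f'' i' \<le> rarr m ''f'' (Suc i')"
  \<comment> \<open>If the last group is the single job \<open>Suc i'\<close>, it disappears and its
    cost is nonnegative. Otherwise the shortened group is still light enough and competes in the
    minimum for \<open>i'\<close>.\<close>
  proof (cases "p = i'")
    case True
    then show ?thesis using D(4) maxcost_nonneg[of "price m a" i' "Suc i'"] price by simp
  next
    case False
    then have "p < i'" using D(2) by simp
    have "wsum (rarr m ''weight'') p i' \<le> wsum (rarr m ''weight'') p (Suc i')"
      using w unfolding wsum_def by (intro sum_mono2) auto
    then have "rarr m ''f'' i' \<le> rarr m ''f'' p + maxcost (price m a) p i'"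
      using dp_cellD(6)[OF dp, of i' a p] D(1,3) \<open>p < i'\<close> step.prems by auto
    also have "\<dots> \<le> rarr m ''f'' (Suc i')" using D(4) maxcost_extend[OF \<open>p < i'\<close>, of "price m a"] by simp
    finally show ?thesis .
  qed
  then show ?case using step by simp
qed simp

lemma minima_cong:
  assumes min: "minima f s D lo hi mid mv ms" and eq: "\<And>x. lo \<le> x \<Longrightarrow> x < hi \<Longrightarrow> f' (D x) = f (D x)"
  shows "minima f' s D lo hi mid mv ms"
proof -
  have "ismin f' s D r b u v" if "ismin f s D r b u v" "lo \<le> u" "v < hi" for r b u v
    using that eq by (intro ismin_cong[OF that(1)]) auto
  then show ?thesis using min unfolding minima_def by auto
qed

text \<open>Block values read \<open>f\<close> at left ends only, all of which are below
  \<open>j\<close>; so the entry for job \<open>j\<close> itself may be written after the deques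
  have advanced to \<open>j\<close>.\<close>

lemma deque_inv_f_upd:
  assumes inv: "deque_inv m b j"
    and eq: "\<forall>X\<in>{''L'', ''lo'', ''hi'', ''mid'', ''D'', ''ms''}. narr m' X = narr m X"
      "\<forall>X\<in>{''S'', ''mv'', ''weight'', ''threshold'', ''cost''}. rarr m' X = rarr m X"
      "nvar m' ''k'' = nvar m ''k''" "\<And>i. i < j \<Longrightarrow> rarr m' ''f'' i = rarr m ''f'' i"
  shows "deque_inv m' b j" "pot m' b i = pot m b i"
proof -
  have rows: "D_row m' b = D_row m b" "mv_row m' b = mv_row m b" "ms_row m' b = ms_row m b" "price m' = price m"
    by (auto simp: D_row_def mv_row_def ms_row_def price_def eq fun_eq_iff)
  show "pot m' b i = pot m b i" by (simp add: pot_def eq)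
  have win: "window m' b j" using inv unfolding deque_inv_def window_def by (simp add: rows eq)
  have less: "D_row m b x < j" if "narr m ''lo'' b \<le> x" "x < narr m ''hi'' b" for x
    using inv that deque_less[of "price m b" "D_row m b" "narr m ''lo'' b" "narr m ''hi'' b" x "narr m ''hi'' b"]
    unfolding deque_inv_def window_def by auto
  have "minima_of m' b"
    using minima_cong[OF conjunct2[OF inv[unfolded deque_inv_def]], of "rarr m' ''f''"] less eq
    by (simp add: rows)
  with win show "deque_inv m' b j" unfolding deque_inv_def ..
qed

section \<open>One step of the dynamic program\<close>

definition process_job :: com where
  "process_job =
     Seq (NAssign ''j'' (NAdd (NVar ''j'') (NLit 1)))
    (Seq (NAssign ''bt'' (NLit 0))
    (Seq (NAssign ''a'' (NLit 0))
    (Seq process_types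
         (Cond (NEq (NVar ''bt'') (NLit 0)) (NAssign ''feasible'' (NLit 0))
            (Seq (RStore ''f'' (NVar ''j'') (RVar ''bv''))
            (Seq (NStore ''pred'' (NVar ''j'') (NVar ''bs''))
            (Seq (NStore ''typ'' (NVar ''j'') (NVar ''bt''))
                 (NStore ''cnt'' (NVar ''j'') (NAdd (NArr ''cnt'' (NVar ''bs'')) (NLit 1))))))))))"

definition same_input :: "memory \<Rightarrow> memory \<Rightarrow> bool" where
  "same_input m m' \<longleftrightarrow> nvar m' ''n'' = nvar m ''n'' \<and> nvar m' ''k'' = nvar m ''k'' \<and>
     rarr m' ''weight'' = rarr m ''weight'' \<and> rarr m' ''cost'' = rarr m ''cost'' \<and>
     rarr m' ''threshold'' = rarr m ''threshold'' \<and> narr m' ''end'' = narr m ''end''"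

text \<open>After a solvable prefix, job \<open>Suc j\<close> can form a group of its own whenever
  some type can carry it. Finding no candidate therefore means that this job is too heavy for every
  type.\<close>

lemma wp_process_job:
  fixes m :: memory
  defines "k \<equiv> nvar m ''k''" and "j \<equiv> nvar m ''j''"
  assumes w: "\<And>i. 0 \<le> rarr m ''weight'' i" and th: "\<And>a. 0 \<le> rarr m ''threshold'' a"
    and c: "\<And>p. 0 \<le> rarr m ''cost'' p" and feas: "nvar m ''feasible'' = 1"
    and dp: "dp m j" and inv: "\<forall>b\<in>{1..k}. deque_inv m b j"
    and Q: "\<And>t m'. same_input m m' \<Longrightarrow> nvar m' ''j'' = Suc j \<Longrightarrow>
      nvar m' ''feasible'' = 0 \<and> (\<forall>b\<in>{1..k}. rarr m ''threshold'' b < rarr m ''weight'' (Suc j)) \<or>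
      nvar m' ''feasible'' = 1 \<and> 0 < k \<and> dp m' (Suc j) \<and> (\<forall>b\<in>{1..k}. deque_inv m' b (Suc j)) \<Longrightarrow>
      t + (\<Sum>b\<in>{1..k}. pot m' b (Suc j)) \<le> (\<Sum>b\<in>{1..k}. pot m b j) + 40000 * k + 300 \<Longrightarrow> Q t m'"
  shows "wp process_job Q m"
proof -
  define m1 where "m1 = m\<lparr>nvar := (nvar m)(''j'' := Suc j, ''bt'' := 0, ''a'' := 0)\<rparr>"
  have m1: "nvar m1 ''a'' = 0" "nvar m1 ''k'' = k" "nvar m1 ''j'' = Suc j" "rarr m1 = rarr m" "narr m1 = narr m"
    "nvar m1 ''feasible'' = 1" "nvar m1 ''n'' = nvar m ''n''" "price m1 = price m"
    by (simp_all add: m1_def k_def feas price_def fun_eq_iff)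
  have inv1: "deque_inv m1 b i \<longleftrightarrow> deque_inv m b i" "pot m1 b i = pot m b i" for b i
  proof -
    have "D_row m1 = D_row m" "mv_row m1 = mv_row m" "ms_row m1 = ms_row m"
      by (auto simp: m1_def D_row_def mv_row_def ms_row_def fun_eq_iff)
    then show "deque_inv m1 b i \<longleftrightarrow> deque_inv m b i" "pot m1 b i = pot m b i"
      by (simp_all add: deque_inv_def window_def pot_def m1)
  qed
  let ?P = "\<lambda>t m2. same_dp m1 m2 \<and> (\<forall>b\<in>{1..k}. deque_inv m2 b (Suc j)) \<and>
      best_of (\<Union>b\<in>{1..k}. candidates m1 b (Suc j)) m2 \<and>
      t + (\<Sum>b\<in>{1..k}. pot m2 b (Suc j)) \<le> (\<Sum>b\<in>{1..k}. pot m b j) + 40000 * k + 100"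
  have "wp process_types ?P m1"
  proof (rule wp_process_types)
    show "rarr m1 ''f'' i \<le> rarr m1 ''f'' i'" if "i \<le> i'" "i' < nvar m1 ''j''" for i i'
      using dp_mono[OF dp w c that(1)] that(2) m1 by simp
    show "best_of {} m1" by (simp add: best_of_def m1_def)
  qed (use m1 w th inv inv1 in auto)
  \<comment> \<open>The 8 accounts for the three assignments in front of
    \<open>process_types\<close>.\<close>
  moreover have "wp (Cond (NEq (NVar ''bt'') (NLit 0)) (NAssign ''feasible'' (NLit 0))
            (Seq (RStore ''f'' (NVar ''j'') (RVar ''bv''))
            (Seq (NStore ''pred'' (NVar ''j'') (NVar ''bs''))
            (Seq (NStore ''typ'' (NVar ''j'') (NVar ''bt''))
                 (NStore ''cnt'' (NVar ''j'') (NAdd (NArr ''cnt'' (NVar ''bs'')) (NLit 1)))))))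
         (\<lambda>t'. Q (8 + (t + t'))) m2" if P: "?P t m2" for t m2
  proof -
    have same: "same_dp m1 m2" and inv2: "\<forall>b\<in>{1..k}. deque_inv m2 b (Suc j)"
      and best: "best_of (\<Union>b\<in>{1..k}. candidates m1 b (Suc j)) m2"
      and t: "t + (\<Sum>b\<in>{1..k}. pot m2 b (Suc j)) \<le> (\<Sum>b\<in>{1..k}. pot m b j) + 40000 * k + 100"
      using P by auto
    have env: "nvar m2 ''n'' = nvar m ''n''" "nvar m2 ''k'' = k" "nvar m2 ''j'' = Suc j" "nvar m2 ''feasible'' = 1"
      "rarr m2 ''weight'' = rarr m ''weight''" "rarr m2 ''cost'' = rarr m ''cost''"
      "rarr m2 ''threshold'' = rarr m ''threshold''" "rarr m2 ''f'' = rarr m ''f''"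
      "narr m2 ''cnt'' = narr m ''cnt''" "narr m2 ''pred'' = narr m ''pred''"
      "narr m2 ''typ'' = narr m ''typ''" "narr m2 ''end'' = narr m ''end''"
      using same m1 unfolding same_dp_def by auto
    have price: "price m2 = price m" by (auto simp: price_def env k_def fun_eq_iff)
    show ?thesis
    proof (cases "nvar m2 ''bt'' = 0")
      case True
      define m3 where "m3 = m2\<lparr>nvar := (nvar m2)(''feasible'' := 0)\<rparr>"
      have "rarr m ''threshold'' b < rarr m ''weight'' (Suc j)" if b: "b \<in> {1..k}" for b
      proof (rule ccontr)
        assume "\<not> rarr m ''threshold'' b < rarr m ''weight'' (Suc j)"
        then have "(b, j, rarr m ''f'' j + maxcost (price m b) j (Suc j)) \<in> candidates m1 b (Suc j)"
          unfolding candidates_def by (auto simp: m1 wsum_def)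
        then show False using best b True unfolding best_of_def by fastforce
      qed
      then have "Q s m3" if "s \<le> t + 100" for s
        using that t by (intro Q) (auto simp: same_input_def m3_def env k_def pot_def)
      then show ?thesis unfolding wp_simps using True by (simp add: m3_def)
    next
      case False
      define a p v where "a = nvar m2 ''bt''" and "p = nvar m2 ''bs''" and "v = rvar m2 ''bv''"
      obtain b where b: "b \<in> {1..k}" "(a, p, v) \<in> candidates m1 b (Suc j)"
        using best False unfolding best_of_def a_def p_def v_def by blast
      then have cand: "a \<in> {1..k}" "p < Suc j" "wsum (rarr m ''weight'') p (Suc j) \<le> rarr m ''threshold'' a"
        "v = rarr m ''f'' p + maxcost (price m a) p (Suc j)"
        unfolding candidates_def by (auto simp: m1)
      have opt: "v \<le> rarr m ''f'' st + maxcost (price m b) st (Suc j)"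
        if "b \<in> {1..k}" "st < Suc j" "wsum (rarr m ''weight'') st (Suc j) \<le> rarr m ''threshold'' b" for b st
      proof -
        have "(b, st, rarr m ''f'' st + maxcost (price m b) st (Suc j)) \<in> candidates m1 b (Suc j)"
          using that unfolding candidates_def by (auto simp: m1)
        then show ?thesis using best that unfolding best_of_def v_def by fastforce
      qed
      define m3 where "m3 = m2\<lparr>rarr := (rarr m2)(''f'' := (rarr m2 ''f'')(Suc j := v)),
        narr := (narr m2)(''pred'' := (narr m2 ''pred'')(Suc j := p), ''typ'' := (narr m2 ''typ'')(Suc j := a),
          ''cnt'' := (narr m2 ''cnt'')(Suc j := Suc (narr m2 ''cnt'' p)))\<rparr>"
      have m3: "nvar m3 = nvar m2" "rarr m3 ''f'' = (rarr m ''f'')(Suc j := v)"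
        "narr m3 ''pred'' = (narr m ''pred'')(Suc j := p)" "narr m3 ''typ'' = (narr m ''typ'')(Suc j := a)"
        "narr m3 ''cnt'' = (narr m ''cnt'')(Suc j := Suc (narr m ''cnt'' p))"
        "rarr m3 ''weight'' = rarr m ''weight''" "rarr m3 ''cost'' = rarr m ''cost''"
        "rarr m3 ''threshold'' = rarr m ''threshold''" "price m3 = price m"
        by (auto simp: m3_def env price_def fun_eq_iff k_def)
      have "deque_inv m3 b (Suc j)" "pot m3 b (Suc j) = pot m2 b (Suc j)" if "b \<in> {1..k}" for b
        using deque_inv_f_upd[OF inv2[rule_format, OF that], of m3] by (auto simp: m3_def)
      moreover have "dp_cell m3 (Suc j)"
        unfolding dp_cell_def Let_def m3 using cand opt by (auto simp: env)
      moreover have "dp_cell m3 i" if "i \<in> {1..j}" for i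
        using dp_cellD[OF dp, of i] that unfolding dp_cell_def Let_def m3 by (auto simp: env k_def)
      ultimately have "dp m3 (Suc j)" "\<forall>b\<in>{1..k}. deque_inv m3 b (Suc j)"
        "(\<Sum>b\<in>{1..k}. pot m3 b (Suc j)) = (\<Sum>b\<in>{1..k}. pot m2 b (Suc j))"
        using dp unfolding dp_def by (auto simp: m3 le_Suc_eq)
      then have "Q s m3" if "s \<le> t + 100" for s
        using that t cand(1) by (intro Q) (auto simp: same_input_def m3 env k_def m3_def)
      then show ?thesis unfolding wp_simps using False
        by (simp add: m3_def env a_def p_def v_def)
    qed
  qed
  ultimately have "wp process_types (\<lambda>t. wp (Cond (NEq (NVar ''bt'') (NLit 0)) (NAssign ''feasible'' (NLit 0))
            (Seq (RStore ''f'' (NVar ''j'') (RVar ''bv''))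
            (Seq (NStore ''pred'' (NVar ''j'') (NVar ''bs''))
            (Seq (NStore ''typ'' (NVar ''j'') (NVar ''bt''))
                 (NStore ''cnt'' (NVar ''j'') (NAdd (NArr ''cnt'' (NVar ''bs'')) (NLit 1)))))))
         (\<lambda>t'. Q (8 + (t + t')))) m1"
    by (rule wp_mono)
  then show ?thesis
    unfolding process_job_def wp_Seq[of "NAssign _ _"] wp_Seq[of process_types] wp_NAssign[of "''j''"]
      wp_NAssign[of "''bt''"] wp_NAssign[of "''a''"]
    by (simp add: m1_def j_def add.assoc eval_nat_numeral)
qed

definition main_loop :: com where
  "main_loop =
     While (Conj (NEq (NVar ''feasible'') (NLit 1)) (NLess (NVar ''j'') (NVar ''n''))) process_job"

text \<open>Also covers \<open>k = 0\<close>, where it holds as soon as there is a job.\<close>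

definition infeasible :: "memory \<Rightarrow> bool" where
  "infeasible m \<longleftrightarrow>
     (\<exists>i\<in>{1..nvar m ''n''}. \<forall>b\<in>{1..nvar m ''k''}. rarr m ''threshold'' b < rarr m ''weight'' i)"

lemma same_input_trans: "same_input m m' \<Longrightarrow> same_input m' m'' \<Longrightarrow> same_input m m''"
  unfolding same_input_def by simp

text \<open>The 1000 in the measure is granted while the prefix is solvable and pays for the
  constant part of a failing iteration; for \<open>k = 0\<close>, where the product vanishes,
  nothing else is left. A successful iteration implies \<open>0 < k\<close>, so its constant part
  fits between \<open>40000 * k\<close> and \<open>41000 * k\<close>.\<close>

lemma wp_main_loop:
  fixes m :: memory
  defines "k \<equiv> nvar m ''k''" and "n \<equiv> nvar m ''n''"
  assumes w: "\<And>i. 0 \<le> rarr m ''weight'' i" and th: "\<And>a. 0 \<le> rarr m ''threshold'' a"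
    and c: "\<And>p. 0 \<le> rarr m ''cost'' p" and feas: "nvar m ''feasible'' = 1" and j: "nvar m ''j'' = 0"
    and dp: "dp m 0" and inv: "\<forall>b\<in>{1..k}. deque_inv m b 0" and pot0: "\<And>b. pot m b 0 = 0"
    and Q: "\<And>t m'. same_input m m' \<Longrightarrow> nvar m' ''feasible'' = 0 \<and> infeasible m \<or>
        nvar m' ''feasible'' = 1 \<and> dp m' n \<and> (0 < n \<longrightarrow> 0 < k) \<Longrightarrow>
      t \<le> 41000 * k * n + 1100 \<Longrightarrow> Q t m'"
  shows "wp main_loop Q m"
  unfolding main_loop_def
proof (rule wp_While[where Inv = "\<lambda>m'. same_input m m' \<and> nvar m' ''j'' \<le> n \<and>
      (nvar m' ''feasible'' = 0 \<and> infeasible m \<or> nvar m' ''feasible'' = 1 \<and> dp m' (nvar m' ''j'') \<and>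
         (\<forall>b\<in>{1..k}. deque_inv m' b (nvar m' ''j'')) \<and> (0 < nvar m' ''j'' \<longrightarrow> 0 < k))" and
      \<Phi> = "\<lambda>m'. (\<Sum>b\<in>{1..k}. pot m' b (nvar m' ''j'')) +
        (if nvar m' ''feasible'' = 1 then 41000 * k * (n - nvar m' ''j'') + 1000 else 0)"], goal_cases)
  case 1
  show ?case using feas j dp inv by (simp add: same_input_def)
next
  case (3 t m')
  from 3(1) have "nvar m' ''n'' = n" unfolding same_input_def n_def by simp
  with 3 show ?case by (intro Q) (auto simp: j feas pot0)
next
  case (2 m')
  define j where "j = nvar m' ''j''"
  have same: "same_input m m'" using 2 by simp
  have env: "nvar m' ''n'' = n" "nvar m' ''k'' = k" "rarr m' ''weight'' = rarr m ''weight''"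
    "rarr m' ''cost'' = rarr m ''cost''" "rarr m' ''threshold'' = rarr m ''threshold''"
    using same unfolding same_input_def n_def k_def by auto
  have g: "nvar m' ''feasible'' = 1" "j < n" using 2(2) env by (auto simp: j_def)
  have dp': "dp m' j" "\<forall>b\<in>{1..k}. deque_inv m' b j" using 2(1) g(1) by (auto simp: j_def)
  show ?case
  proof (rule wp_process_job, unfold env j_def[symmetric], goal_cases)
    case 1 show ?case using w .
  next
    case 2 show ?case using th .
  next
    case 3 show ?case using c .
  next
    case 4 show ?case using g by simp
  next
    case 5 show ?case using dp' by simp
  next
    case 6 show ?case using dp' by simp
  next
    case (7 t x)
    have n_j: "n - j = Suc (n - Suc j)" using g(2) by simp
    have same': "same_input m x" by (rule same_input_trans[OF same 7(1)])
    have "infeasible m" if "\<forall>b\<in>{1..k}. rarr m ''threshold'' b < rarr m ''weight'' (Suc j)"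
      using that g(2) unfolding infeasible_def n_def k_def by auto
    moreover have "40000 * k + 300 \<le> 41000 * k * (n - j) + 900" unfolding n_j by (simp add: algebra_simps)
    moreover have "40000 * k + 400 + 41000 * k * (n - Suc j) \<le> 41000 * k * (n - j)" if "0 < k"
      using that unfolding n_j by (simp add: algebra_simps)
    ultimately show ?case using 7(2-4) g same' by (auto simp: n_j)
  qed
qed

section \<open>Reconstruction of the groups\<close>

definition output_groups :: com where
  "output_groups =
     Seq (NAssign ''groups'' (NArr ''cnt'' (NVar ''n'')))
    (Seq (NAssign ''x'' (NVar ''n''))
      (While (NLess (NLit 0) (NVar ''x''))
        (Seq (NStore ''end'' (NArr ''cnt'' (NVar ''x'')) (NVar ''x''))
        (Seq (NStore ''agent'' (NArr ''cnt'' (NVar ''x'')) (NArr ''typ'' (NVar ''x'')))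
             (NAssign ''x'' (NArr ''pred'' (NVar ''x'')))))))"

text \<open>The groups numbered above \<open>cnt x\<close> have been written when the backtracking has reached job \<open>x\<close>,
  and \<open>x\<close> takes the place of the missing entry for group \<open>cnt x\<close>.\<close>

definition chain :: "memory \<Rightarrow> nat \<Rightarrow> nat \<Rightarrow> memory \<Rightarrow> bool" where
  "chain m n x m' \<longleftrightarrow>
     (let r = narr m ''cnt'' n; c = narr m ''cnt''; E = (narr m' ''end'')(c x := x) in
      nvar m' ''groups'' = r \<and> narr m' ''end'' 0 = 0 \<and> x \<le> n \<and> c x \<le> r \<and> E r = n \<and>
      (\<forall>g. c x < g \<and> g \<le> r \<longrightarrow> 0 < E g \<and> E g \<le> n \<and> c (E g) = g \<and>
         narr m' ''agent'' g = narr m ''typ'' (E g) \<and> narr m ''pred'' (E g) = E (g - 1)))"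

text \<open>Along \<open>pred\<close> the count drops by one, so groups met from last to first go
  straight to their final cells without a reversal.\<close>

lemma wp_output_groups:
  fixes m :: memory
  defines "n \<equiv> nvar m ''n''"
  assumes dp: "dp m n" and end0: "narr m ''end'' 0 = 0"
    and Q: "\<And>t m'. chain m n 0 m' \<Longrightarrow> nvar m' ''feasible'' = nvar m ''feasible'' \<Longrightarrow> t \<le> 100 * n + 100 \<Longrightarrow> Q t m'"
  shows "wp output_groups Q m"
  unfolding output_groups_def wp_Seq wp_NAssign
proof (rule wp_While[where Inv = "\<lambda>m'. chain m n (nvar m' ''x'') m' \<and> nvar m' ''feasible'' = nvar m ''feasible'' \<and>
      narr m' ''cnt'' = narr m ''cnt'' \<and> narr m' ''pred'' = narr m ''pred'' \<and> narr m' ''typ'' = narr m ''typ''" and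
      \<Phi> = "\<lambda>m'. 100 * nvar m' ''x''"], goal_cases)
  case 1
  show ?case using end0 by (simp add: chain_def Let_def n_def)
next
  case (3 t m')
  then show ?case by (intro Q) (auto simp: n_def)
next
  case (2 m')
  define x c E r where "x = nvar m' ''x''" and "c = narr m ''cnt''" and "E = (narr m' ''end'')(narr m ''cnt'' x := x)"
    and "r = narr m ''cnt'' n"
  define p where "p = narr m ''pred'' x"
  have ch: "nvar m' ''groups'' = r" "narr m' ''end'' 0 = 0" "x \<le> n" "c x \<le> r" "E r = n"
    "\<And>g. c x < g \<Longrightarrow> g \<le> r \<Longrightarrow> 0 < E g \<and> E g \<le> n \<and> c (E g) = g \<and>
         narr m' ''agent'' g = narr m ''typ'' (E g) \<and> narr m ''pred'' (E g) = E (g - 1)"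
    using 2(1) unfolding chain_def Let_def x_def[symmetric] c_def E_def r_def by auto
  have x: "0 < x" using 2(2) by (simp add: x_def)
  have p: "p < x" "c x = Suc (c p)"
    using dp_cellD(2,5)[OF dp x ch(3)] by (auto simp: p_def c_def)
  have cp0: "c p = 0 \<longleftrightarrow> p = 0"
    using dp_cellD(5)[OF dp, of p] dp p(1) ch(3) unfolding dp_def c_def by (cases "p = 0") auto
  define E' where "E' = E(c p := p)"
  have "E' g = E g" if "g \<noteq> c p" for g using that unfolding E'_def by simp
  \<comment> \<open>For \<open>g = c x\<close> the preceding end is the new entry \<open>p\<close>,
    the predecessor of \<open>x\<close>; for larger \<open>g\<close> neither \<open>E g\<close> nor
    \<open>E (g - 1)\<close> is altered.\<close>
  then have new: "0 < E' g \<and> E' g \<le> n \<and> c (E' g) = g \<and>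
      (if g = c x then narr m ''typ'' x else narr m' ''agent'' g) = narr m ''typ'' (E' g) \<and>
      narr m ''pred'' (E' g) = E' (g - 1)" if "c p < g" "g \<le> r" for g
    using ch(6)[of g] that p x ch(3) by (cases "g = c x") (auto simp: E'_def E_def c_def[symmetric] p_def)
  define m1 where "m1 = m'\<lparr>narr := (narr m')(''end'' := (narr m' ''end'')(c x := x),
      ''agent'' := (narr m' ''agent'')(c x := narr m ''typ'' x)), nvar := (nvar m')(''x'' := p)\<rparr>"
  have m1: "(narr m1 ''end'')(narr m ''cnt'' p := p) = E'" "nvar m1 ''groups'' = r" "narr m1 ''end'' 0 = 0"
    "narr m1 ''agent'' g = (if g = c x then narr m ''typ'' x else narr m' ''agent'' g)" for g
    using ch(1,2) p by (auto simp: m1_def E'_def E_def c_def)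
  have "chain m n p m1"
    unfolding chain_def Let_def m1 r_def[symmetric]
    using new ch(3-5) p unfolding c_def[symmetric] by (auto simp: E'_def)
  then show ?case
    using 2(1) p(1)
    by (simp add: wp_simps x_def[symmetric] c_def[symmetric] p_def[symmetric] m1_def)
qed


section \<open>Correctness of the dynamic program\<close>

lemma maxcost_eq_batch_cost:
  assumes "\<And>i. i \<in> {1..njobs I} \<Longrightarrow> s i = setup_cost I i a" "j \<le> njobs I"
  shows "maxcost s st j = batch_cost I a {Suc st..j}"
  unfolding maxcost_def batch_cost_def by (intro arg_cong[where f = Max] image_cong) (use assms in auto)

lemma can_process_iff_wsum:
  assumes "\<And>i. i \<in> {1..njobs I} \<Longrightarrow> w i = weight I i" "j \<le> njobs I"
  shows "can_process I a {Suc st..j} \<longleftrightarrow> wsum w st j \<le> threshold I a"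
proof -
  have "wsum w st j = (\<Sum>i\<in>{Suc st..j}. weight I i)"
    unfolding wsum_def by (rule sum.cong) (use assms in auto)
  then show ?thesis unfolding can_process_def by simp
qed

definition represents :: "memory \<Rightarrow> pa_instance \<Rightarrow> bool" where
  "represents m I \<longleftrightarrow> nvar m ''n'' = njobs I \<and> nvar m ''k'' = ntypes I \<and>
     (\<forall>i\<in>{1..njobs I}. rarr m ''weight'' i = weight I i) \<and>
     (\<forall>a\<in>{1..ntypes I}. rarr m ''threshold'' a = threshold I a) \<and>
     (\<forall>i\<in>{1..njobs I}. \<forall>a\<in>{1..ntypes I}. price m a i = setup_cost I i a)"

lemma represents_group:
  assumes "represents m I" "a \<in> {1..ntypes I}" "j \<le> njobs I"
  shows "can_process I a {Suc st..j} \<longleftrightarrow> wsum (rarr m ''weight'') st j \<le> rarr m ''threshold'' a"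
    "batch_cost I a {Suc st..j} = maxcost (price m a) st j"
  using can_process_iff_wsum[of I "rarr m ''weight''" j a st] maxcost_eq_batch_cost[of I "price m a" a j st] assms
  unfolding represents_def by auto

text \<open>A partition is an unordered set, so its last group is identified as the one containing
  \<open>j\<close>. It must end at \<open>j\<close>, and removing it leaves a partition of a shorter
  prefix, to which the induction applies.\<close>

lemma dp_lower_bound:
  assumes rep: "represents m I" and dp: "dp m (njobs I)" and j: "j \<le> njobs I"
    and P: "partition_on {1..j} P"
    and grp: "\<forall>G\<in>P. (\<exists>i l. G = {i..l}) \<and> A G \<in> {1..ntypes I} \<and> can_process I (A G) G"
  shows "rarr m ''f'' j \<le> (\<Sum>G\<in>P. batch_cost I (A G) G)"
  using j P grp
proof (induction j arbitrary: P rule: less_induct)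
  case (less j)
  show ?case
  proof (cases "j = 0")
    case True
    then have "P = {}" using less.prems(2) by (simp add: partition_on_empty)
    then show ?thesis using True dp by (simp add: dp_def)
  next
    case False
    have UN: "\<Union>P = {1..j}" and disj: "disjoint P" and ne: "{} \<notin> P"
      using less.prems(2) unfolding partition_on_def by auto
    have "j \<in> \<Union>P" using UN False by simp
    then obtain G where G: "G \<in> P" "j \<in> G" by blast
    obtain i l where il: "G = {i..l}" using less.prems(3) G(1) by blast
    have "G \<subseteq> {1..j}" using UN G(1) by blast
    moreover have "i \<in> G" "l \<in> G" using G(2) il by auto
    moreover have "j \<le> l" using G(2) il by simp
    ultimately have "l = j" "1 \<le> i" "i \<le> j" by auto
    then obtain st where st: "G = {Suc st..j}" "st < j" using il by (cases i) auto
    have finP: "finite P" using less.prems(2) by (rule finite_elements[rotated]) simp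
    have a: "A G \<in> {1..ntypes I}" and cp: "can_process I (A G) G" using less.prems(3) G(1) by auto
    have part: "partition_on {1..st} (P - {G})"
    proof (rule partition_onI)
      show "\<Union>(P - {G}) = {1..st}"
      proof -
        have "\<Union>(P - {G}) = \<Union>P - G"
          using disj G(1) unfolding disjoint_def by blast
        then show ?thesis using UN st by auto
      qed
      show "disjnt p q" if "p \<in> P - {G}" "q \<in> P - {G}" "p \<noteq> q" for p q
        using disj that unfolding disjoint_def disjnt_def by blast
      show "{} \<notin> P - {G}" using ne by blast
    qed
    have "rarr m ''f'' st \<le> (\<Sum>G\<in>P - {G}. batch_cost I (A G) G)"
      using less.IH[OF st(2) _ part] less.prems st(2) by auto
    moreover have "rarr m ''f'' j \<le> rarr m ''f'' st + maxcost (price m (A G)) st j"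
      using dp_cellD(6)[OF dp, of j "A G" st] False less.prems(1) a cp st rep
        represents_group(1)[OF rep a less.prems(1), of st]
      by (auto simp: represents_def)
    moreover have "batch_cost I (A G) G = maxcost (price m (A G)) st j"
      using represents_group(2)[OF rep a less.prems(1)] st(1) by simp
    ultimately show ?thesis
      using sum.remove[OF finP G(1), of "\<lambda>G. batch_cost I (A G) G"] by simp
  qed
qed

text \<open>With nonnegative weights the group of job \<open>i\<close> weighs at least as much as
  \<open>i\<close> alone.\<close>

lemma infeasible_no_solution:
  assumes rep: "represents m I" and pos: "nonneg_instance I" and inf: "infeasible m"
  shows "\<not> feasible I P A"
proof
  assume F: "feasible I P A"
  obtain i where i: "i \<in> {1..njobs I}" "\<forall>b\<in>{1..ntypes I}. threshold I b < weight I i"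
    using inf rep unfolding infeasible_def represents_def by auto
  obtain G where G: "G \<in> P" "i \<in> G" using F i(1) unfolding feasible_def partition_on_def by blast
  then have sub: "G \<subseteq> {1..njobs I}" and a: "A G \<in> {1..ntypes I}" and cp: "can_process I (A G) G"
    using F unfolding feasible_def partition_on_def by auto
  have "weight I i \<le> (\<Sum>i\<in>G. weight I i)"
    using G(2) sub pos finite_subset[OF sub] unfolding nonneg_instance_def
    by (intro member_le_sum) auto
  then show False using cp i(2) a unfolding can_process_def by fastforce
qed

text \<open>The recorded groups cost exactly \<open>f n\<close> in total, which
  \<open>dp_lower_bound\<close> shows to be the least possible.\<close>

lemma chain_optimal:
  assumes rep: "represents m I" and dp: "dp m (njobs I)" and ch: "chain m (njobs I) 0 m'"
  shows "\<exists>P A. returns_solution m' P A \<and> optimal I P A"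
proof -
  define n r E grp where "n = njobs I" and "r = narr m ''cnt'' n" and "E = narr m' ''end''" and "grp = output_group m'"
  have c0: "narr m ''cnt'' 0 = 0" using dp unfolding dp_def by simp
  have "E(0 := 0) = E" if "E 0 = 0" using that by auto
  then have ch': "nvar m' ''groups'' = r" "E 0 = 0" "E r = n"
    "\<And>g. 0 < g \<Longrightarrow> g \<le> r \<Longrightarrow> 0 < E g \<and> E g \<le> n \<and>
         narr m' ''agent'' g = narr m ''typ'' (E g) \<and> narr m ''pred'' (E g) = E (g - 1)"
    using ch unfolding chain_def Let_def c0 r_def[unfolded n_def, symmetric] E_def[symmetric]
    by (auto simp: n_def r_def)
  have grp: "grp g = {Suc (E (g - 1))..E g}" for g unfolding grp_def output_group_def E_def by simp
  have cell: "E (g - 1) < E g" "narr m' ''agent'' g \<in> {1..ntypes I}" "can_process I (narr m' ''agent'' g) (grp g)"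
    "rarr m ''f'' (E g) = rarr m ''f'' (E (g - 1)) + batch_cost I (narr m' ''agent'' g) (grp g)"
    if "g \<in> {1..r}" for g
  proof -
    have g: "0 < E g" "E g \<le> njobs I" "narr m' ''agent'' g = narr m ''typ'' (E g)" "narr m ''pred'' (E g) = E (g - 1)"
      using ch'(4)[of g] that n_def by auto
    note D = dp_cellD[OF dp g(1,2), folded g(3), unfolded g(4)]
    show a: "narr m' ''agent'' g \<in> {1..ntypes I}" using D(1) rep unfolding represents_def by simp
    note R = represents_group[OF rep a g(2), of "E (g - 1)", folded grp]
    show "E (g - 1) < E g" "can_process I (narr m' ''agent'' g) (grp g)"
      "rarr m ''f'' (E g) = rarr m ''f'' (E (g - 1)) + batch_cost I (narr m' ''agent'' g) (grp g)"
      using D(2-4) R by simp_all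
  qed
  have mono: "E g \<le> E h" if "g \<le> h" "h \<le> r" for g h
    using that
  proof (induction h rule: dec_induct)
    case (step h)
    then show ?case using cell(1)[of "Suc h"] by simp
  qed simp
  have disj: "grp g \<inter> grp h = {}" if "g \<in> {1..r}" "h \<in> {1..r}" "g < h" for g h
  proof -
    have "E g \<le> E (h - 1)" using mono[of g "h - 1"] that by auto
    then have "x \<notin> grp h" if "x \<in> grp g" for x using that by (simp add: grp)
    then show ?thesis by blast
  qed
  have ne: "grp g \<noteq> {}" if "g \<in> {1..r}" for g using cell(1)[OF that] by (auto simp: grp)
  have inj: "inj_on grp {1..r}"
    by (rule inj_onI) (metis disj ne Int_absorb linorder_neqE_nat)
  \<comment> \<open>Stated for every prefix of the groups, since both the tiling and the costs
    telescope along \<open>E\<close>.\<close>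
  have UN: "(\<Union>g\<in>{1..q}. grp g) = {1..E q} \<and>
      (\<Sum>g\<in>{1..q}. batch_cost I (narr m' ''agent'' g) (grp g)) = rarr m ''f'' (E q)" if "q \<le> r" for q
    using that
  proof (induction q)
    case 0
    show ?case using ch'(2) dp unfolding dp_def by simp
  next
    case (Suc q)
    have "{1..Suc q} = insert (Suc q) {1..q}" by auto
    then show ?case using Suc cell(1,4)[of "Suc q"] by (auto simp: grp)
  qed
  \<comment> \<open>The agent has to be a function of the group as a set, so the group number is
    recovered from the set; this works because the groups are nonempty and disjoint.\<close>
  define P A where "P = grp ` {1..r}" and "A = (\<lambda>G. narr m' ''agent'' (inv_into {1..r} grp G))"
  have A: "A (grp g) = narr m' ''agent'' g" if "g \<in> {1..r}" for g
    unfolding A_def using inv_into_f_f[OF inj that] by simp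
  have "partition_on {1..n} P"
  proof (rule partition_onI)
    show "\<Union>P = {1..n}" using UN[of r] ch'(3) unfolding P_def by simp
    show "disjnt p q" if "p \<in> P" "q \<in> P" "p \<noteq> q" for p q
      using that disj unfolding P_def disjnt_def by (metis (no_types, lifting) Int_commute imageE linorder_neqE_nat)
    show "{} \<notin> P" using ne unfolding P_def by fastforce
  qed
  then have feas: "feasible I P A"
    unfolding feasible_def P_def using cell(2,3) A by (auto simp: n_def grp)
  have "total_cost I P A = rarr m ''f'' n"
    unfolding total_cost_def P_def sum.reindex[OF inj] comp_def
    using UN[of r] ch'(3) sum.cong[OF refl, of "{1..r}" "\<lambda>g. batch_cost I (A (grp g)) (grp g)"] A by simp
  then have "optimal I P A"
    unfolding optimal_def using feas dp_lower_bound[OF rep dp order_refl]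
    unfolding feasible_def total_cost_def n_def by auto
  moreover have "returns_solution m' P A"
    unfolding returns_solution_def using ch' A by (auto simp: P_def E_def grp_def)
  ultimately show ?thesis by blast
qed

section \<open>The complete program\<close>

definition solver :: com where
  "solver =
     Seq (NAssign ''feasible'' (NLit 1))
    (Seq main_loop
         (Cond (NEq (NVar ''feasible'') (NLit 1)) output_groups Skip))"

lemma price_input_memory:
  assumes "i \<in> {1..njobs I}" "a \<in> {1..ntypes I}"
  shows "price (input_memory I) a i = setup_cost I i a"
proof -
  have k: "nvar (input_memory I) ''k'' = ntypes I" by (simp add: input_memory_def)
  show ?thesis unfolding price_def k cell_def using input_memory_cost[OF assms] .
qed

lemma input_memory_represents: "represents (input_memory I) I"
  unfolding represents_def
  by (intro conjI ballI price_input_memory) (simp_all add: input_memory_def)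

lemma input_memory_nonneg:
  assumes "nonneg_instance I"
  shows "0 \<le> rarr (input_memory I) ''weight'' i" "0 \<le> rarr (input_memory I) ''threshold'' a"
    "0 \<le> rarr (input_memory I) ''cost'' p"
proof -
  show "0 \<le> rarr (input_memory I) ''weight'' i" "0 \<le> rarr (input_memory I) ''threshold'' a"
    using assms by (auto simp: input_memory_def nonneg_instance_def)
  have "0 \<le> setup_cost I ((p - 1) div ntypes I + 1) ((p - 1) mod ntypes I + 1)"
    if p: "p \<in> {1..njobs I * ntypes I}"
  proof -
    have k: "0 < ntypes I" using p by (cases "ntypes I = 0") auto
    have "p - 1 < njobs I * ntypes I" using p by auto
    then have "(p - 1) div ntypes I < njobs I" by (simp add: less_mult_imp_div_less)
    moreover have "(p - 1) mod ntypes I < ntypes I" using k by simp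
    ultimately show ?thesis using assms unfolding nonneg_instance_def by auto
  qed
  then show "0 \<le> rarr (input_memory I) ''cost'' p" by (simp add: input_memory_def)
qed

lemma represents_same_input: "same_input m m' \<Longrightarrow> represents m' I \<longleftrightarrow> represents m I"
  unfolding represents_def same_input_def price_def by simp

text \<open>50000 rounds up the sum of 41000 for the main loop, 100 for backtracking and 1300 for
  additive parts; the maximum with 1 absorbs the latter when \<open>n * k = 0\<close>.\<close>

lemma wp_solver:
  assumes pos: "nonneg_instance I"
  shows "wp solver (\<lambda>t m. t \<le> 50000 * max 1 (njobs I * ntypes I) \<and> correct_output I m) (input_memory I)"
proof -
  define n k where "n = njobs I" and "k = ntypes I"
  define m where "m = (input_memory I)\<lparr>nvar := (nvar (input_memory I))(''feasible'' := 1)\<rparr>"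
  have m: "nvar m ''n'' = n" "nvar m ''k'' = k" "nvar m ''j'' = 0" "nvar m ''feasible'' = 1"
    "narr m = (\<lambda>_ _. 0)" "rarr m = rarr (input_memory I)" "rarr m ''f'' = (\<lambda>_. 0)" "rarr m ''S'' = (\<lambda>_. 0)"
    by (simp_all add: m_def n_def k_def input_memory_def)
  have rep: "represents m I"
    using input_memory_represents[of I] by (simp add: represents_def m_def)
  have nn: "0 \<le> rarr m ''weight'' i" "0 \<le> rarr m ''threshold'' i" "0 \<le> rarr m ''cost'' i" for i
    using input_memory_nonneg[OF pos] m(6) by auto
  have dp0: "dp m 0" by (simp add: dp_def m(5,7))
  have pot0: "pot m b 0 = 0" for b by (simp add: pot_def m)
  \<comment> \<open>In zeroed memory every deque is empty with \<open>lo = hi = mid = 0\<close> and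
    ends at job 0, so no initialization loop over the types is run.\<close>
  have inv0: "deque_inv m b 0" for b
    by (simp add: deque_inv_def window_def deque_def minima_def m(1-5,7,8) D_row_def wsum_def)
  \<comment> \<open>Backtracking is linear in \<open>n\<close>, but it is reached only if jobs come
    with at least one type, so \<open>n * k\<close> covers it.\<close>
  have nk: "n \<le> n * k" if "0 < n \<longrightarrow> 0 < k" using that by (cases "n = 0") auto
  have "wp main_loop (\<lambda>t. wp (Cond (NEq (NVar ''feasible'') (NLit 1)) output_groups Skip)
      (\<lambda>t' m'. 2 + (t + t') \<le> 50000 * max 1 (n * k) \<and> correct_output I m')) m"
  proof (rule wp_main_loop)
    fix t m1
    assume same: "same_input m m1" and t: "t \<le> 41000 * nvar m ''k'' * nvar m ''n'' + 1100"
      and res: "nvar m1 ''feasible'' = 0 \<and> infeasible m \<or>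
        nvar m1 ''feasible'' = 1 \<and> dp m1 (nvar m ''n'') \<and> (0 < nvar m ''n'' \<longrightarrow> 0 < nvar m ''k'')"
    have t': "t \<le> 41000 * (n * k) + 1100" using t by (simp add: m mult.commute mult.left_commute)
    have bound: "t + 100 * n + 200 \<le> 50000 * max 1 (n * k)" if "0 < n \<longrightarrow> 0 < k"
      using nk[OF that] t' max.cobounded1[of 1 "n * k"] max.cobounded2[of "n * k" 1] by linarith
    have bound': "t + 200 \<le> 50000 * max 1 (n * k)"
      using t' max.cobounded1[of 1 "n * k"] max.cobounded2[of "n * k" 1] by linarith
    from res show "wp (Cond (NEq (NVar ''feasible'') (NLit 1)) output_groups Skip)
      (\<lambda>t' m'. 2 + (t + t') \<le> 50000 * max 1 (n * k) \<and> correct_output I m') m1"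
    proof (elim disjE conjE)
      assume f: "nvar m1 ''feasible'' = 0" and inf: "infeasible m"
      have "correct_output I m1"
        using infeasible_no_solution[OF rep pos inf] f unfolding correct_output_def by auto
      then show ?thesis using f bound' by (simp add: wp_simps)
    next
      assume f: "nvar m1 ''feasible'' = 1" and dp: "dp m1 (nvar m ''n'')"
        and n_pos: "0 < nvar m ''n'' \<longrightarrow> 0 < nvar m ''k''"
      have e: "nvar m1 ''n'' = n" "narr m1 ''end'' 0 = 0" "represents m1 I"
        using same rep represents_same_input[OF same] by (simp_all add: same_input_def m)
      have "wp output_groups (\<lambda>t' m'. chain m1 n 0 m' \<and> nvar m' ''feasible'' = 1 \<and> t' \<le> 100 * n + 100) m1"
        by (rule wp_output_groups) (use e dp m f in auto)
      moreover have "correct_output I m'" if "chain m1 n 0 m'" "nvar m' ''feasible'' = 1" for m'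
      proof -
        have "dp m1 (njobs I)" "chain m1 (njobs I) 0 m'"
          using dp that(1) m(1) n_def by simp_all
        then obtain P A where "returns_solution m' P A" "optimal I P A"
          using chain_optimal[OF e(3)] by blast
        then show ?thesis using that(2) unfolding correct_output_def optimal_def by auto
      qed
      moreover have "t + 100 * n + 200 \<le> 50000 * max 1 (n * k)"
        using bound n_pos m(1,2) by simp
      ultimately show ?thesis
        unfolding wp_Cond using f by (auto elim: wp_mono)
    qed
  qed (use nn dp0 inv0 pot0 m in auto)
  then show ?thesis
    unfolding solver_def wp_Seq wp_NAssign by (simp add: m_def n_def k_def)
qed

theorem theorem2:
  "\<exists>(c :: com) (C :: nat). solves_in_time c (\<lambda>n k. C * max 1 (n * k))"
  using wp_solver unfolding solves_in_time_def wp_def by blast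

end
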